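(* Let $p>2$. As $r\to\infty$, $$1-f_p^2(r)\sim\frac p2\,\frac1{r^p}\qquad\text{and}\qquad f_p'(r)\sim\frac{p^2}{4}\,\frac1{r^{p+1}},$$ where $a(r)\sim b(r)$ means $a(r)/b(r)\to1$.
   Context: For $p>2$, $$X_p=\Big\{f\in W^{1,p}_{\mathrm{loc}}(0,\infty):\ \int_0^\infty\big(|f'|^2+\tfrac{f^2}{r^2}\big)^{p/2}\,r\,dr<\infty\Big\}$$ (real-valued functions; every $f\in X_p$ has a continuous representative on $[0,\infty)$ with $f(0)=0$), and $$I_p(f)=\int_0^\infty\Big\{\Big[(f')^2+\frac{f^2}{r^2}\Big]^{p/2}+\frac12(1-f^2)^2\Big\}\,r\,dr.$$ $f_p$ denotes the unique non-negative minimizer of $I_p$ over $X_p$; it is of class $C^\infty$ on $(0,\infty)$. *)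

theory Defs
  imports "HOL-Analysis.Analysis" "HOL-Library.Landau_Symbols"
begin

text \<open>
  Functions on $(0,\infty)$ are total functions on the reals whose values on $(-\infty,0]$ are
  never inspected.  Sobolev functions are handled through arbitrary
  representatives: membership in the spaces and the energy below do not change if a function is
  modified on a Lebesgue null set.
\<close>

text \<open>Class $C^\infty$; intended for open \<open>S\<close>, as \<open>deriv\<close> is the two-sided derivative.\<close>

definition smooth_on :: "real set \<Rightarrow> (real \<Rightarrow> real) \<Rightarrow> bool" where
  "smooth_on S f \<longleftrightarrow> (\<forall>n. \<forall>x\<in>S. (deriv ^^ n) f differentiable (at x))"

definition test_fun :: "(real \<Rightarrow> real) \<Rightarrow> bool" where
  "test_fun \<phi> \<longleftrightarrow> smooth_on UNIV \<phi> \<and>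
     (\<exists>K. compact K \<and> K \<subseteq> {0<..} \<and> (\<forall>x. x \<notin> K \<longrightarrow> \<phi> x = 0))"

definition Lp_loc :: "real \<Rightarrow> (real \<Rightarrow> real) \<Rightarrow> bool" where
  "Lp_loc p f \<longleftrightarrow> f \<in> borel_measurable (lebesgue_on {0<..}) \<and>
     (\<forall>K. compact K \<and> K \<subseteq> {0<..} \<longrightarrow> integrable (lebesgue_on K) (\<lambda>x. \<bar>f x\<bar> powr p))"

definition has_weak_deriv :: "(real \<Rightarrow> real) \<Rightarrow> (real \<Rightarrow> real) \<Rightarrow> bool" where
  "has_weak_deriv f g \<longleftrightarrow> Lp_loc 1 f \<and> Lp_loc 1 g \<and>
     (\<forall>\<phi>. test_fun \<phi> \<longrightarrow>
        (LINT x:{0<..}|lebesgue. f x * deriv \<phi> x) = - (LINT x:{0<..}|lebesgue. g x * \<phi> x))"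

text \<open>Weak derivatives are unique up to null sets, so the choice made here is immaterial.\<close>

definition weak_deriv :: "(real \<Rightarrow> real) \<Rightarrow> real \<Rightarrow> real" where
  "weak_deriv f = (SOME g. has_weak_deriv f g)"

definition W1p_loc :: "real \<Rightarrow> (real \<Rightarrow> real) set" where
  "W1p_loc p = {f. Lp_loc p f \<and> (\<exists>g. has_weak_deriv f g \<and> Lp_loc p g)}"

definition X_space :: "real \<Rightarrow> (real \<Rightarrow> real) set" where
  "X_space p = {f \<in> W1p_loc p.
     (\<integral>\<^sup>+r\<in>{0<..}. ennreal ((\<bar>weak_deriv f r\<bar>\<^sup>2 + (f r)\<^sup>2 / r\<^sup>2) powr (p/2) * r) \<partial>lebesgue) < \<infinity>}"

text \<open>The value is \<open>\<infinity>\<close> for some members of \<open>X_space p\<close>, for example for the zero function.\<close>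

definition I_energy :: "real \<Rightarrow> (real \<Rightarrow> real) \<Rightarrow> ennreal" where
  "I_energy p f =
     (\<integral>\<^sup>+r\<in>{0<..}. ennreal ((((weak_deriv f r)\<^sup>2 + (f r)\<^sup>2 / r\<^sup>2) powr (p/2)
                          + 1/2 * (1 - (f r)\<^sup>2)\<^sup>2) * r) \<partial>lebesgue)"

text \<open>Non-negativity is imposed at every point (not just almost everywhere); for
  continuous \<open>f\<close> this makes no difference.\<close>

definition nonneg_minimizer :: "real \<Rightarrow> (real \<Rightarrow> real) \<Rightarrow> bool" where
  "nonneg_minimizer p f \<longleftrightarrow> f \<in> X_space p \<and> (\<forall>r>0. 0 \<le> f r) \<and>
     (\<forall>g\<in>X_space p. I_energy p f \<le> I_energy p g)"

end

theory Submission imports Defs begin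

text \<open>
  Local variations of the minimizer give the Euler--Lagrange equation wherever \<open>f > 0\<close>.
  Finiteness of the energy gives \<open>f \<rightarrow> 1\<close> at infinity and prevents \<open>f\<close> from staying away from \<open>0\<close>
  near the origin; the sign of \<open>f''\<close> at critical points then forces \<open>f' \<ge> 0\<close> near infinity.
  In the equation the terms \<open>p f\<^sup>p\<^sup>-\<^sup>1 r\<^sup>1\<^sup>-\<^sup>p\<close> and \<open>2 f (1 - f\<^sup>2) r\<close> balance at infinity, and comparison with
  \<open>1 - (p/4) r\<^sup>-\<^sup>p \<plusminus> M r\<^sup>-\<^sup>2\<^sup>p\<close> by the maximum principle yields
  \<open>f = 1 - (p/4) r\<^sup>-\<^sup>p + O(r\<^sup>-\<^sup>2\<^sup>p)\<close>. A one-sided bound on \<open>f''\<close> shows \<open>r f' \<rightarrow> 0\<close>, hence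
  \<open>r\<^sup>2 f'' \<rightarrow> 0\<close> by the equation, and interpolating between the remainder and its second derivative
  gives the asymptotics of \<open>f'\<close>.
\<close>

section \<open>Test functions\<close>

lemma smooth_on_coinduct:
  assumes "P f" "\<And>g. P g \<Longrightarrow> \<forall>x\<in>S. g differentiable (at x)" "\<And>g. P g \<Longrightarrow> P (deriv g)"
  shows "smooth_on S f"
proof -
  have "P ((deriv ^^ n) f)" for n
    using assms(1,3) by (induction n) auto
  then show ?thesis
    using assms(2) unfolding smooth_on_def by blast
qed

lemma smooth_onD:
  assumes "smooth_on S f"
  shows "\<And>x. x \<in> S \<Longrightarrow> (f has_real_derivative deriv f x) (at x)" "smooth_on S (deriv f)"
proof -
  show "(f has_real_derivative deriv f x) (at x)" if "x \<in> S" for x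
    using assms[unfolded smooth_on_def, rule_format, OF that, of 0]
    by (simp add: DERIV_deriv_iff_real_differentiable)
  show "smooth_on S (deriv f)"
    unfolding smooth_on_def using assms[unfolded smooth_on_def]
    by (metis comp_apply funpow_Suc_right)
qed

lemma smooth_on_continuous_on:
  assumes "smooth_on S f"
  shows "continuous_on S f"
  by (meson DERIV_continuous_on assms has_field_derivative_at_within smooth_onD(1))

definition flat :: "real \<Rightarrow> nat \<Rightarrow> real \<Rightarrow> real" where
  "flat c i t = (if t > 0 then exp (- c / t) / t ^ i else 0)"

lemma flat_le_square:
  assumes "c > 0"
  shows "\<bar>flat c i t\<bar> \<le> fact (i + 2) / c ^ (i + 2) * t\<^sup>2"
proof (cases "t > 0")
  case True
  have "(c / t) ^ (i + 2) / fact (i + 2) \<le> exp (c / t)"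
  proof -
    have "(\<Sum>n\<in>{i+2}. (c / t) ^ n /\<^sub>R fact n) \<le> (\<Sum>n. (c / t) ^ n /\<^sub>R fact n)"
      using True assms by (intro sum_le_suminf summable_exp_generic) auto
    then show ?thesis
      by (simp add: exp_def divide_inverse mult.commute)
  qed
  then have "inverse (exp (c / t)) \<le> inverse ((c / t) ^ (i + 2) / fact (i + 2))"
    using True assms by (intro le_imp_inverse_le) auto
  then have "exp (- c / t) \<le> fact (i + 2) / (c / t) ^ (i + 2)"
    by (simp add: exp_minus del: fact_Suc power_Suc add_2_eq_Suc')
  also have "\<dots> = fact (i + 2) / c ^ (i + 2) * t ^ (i + 2)"
    by (simp add: power_divide)
  finally have "exp (- c / t) / t ^ i \<le> fact (i + 2) / c ^ (i + 2) * t ^ (i + 2) / t ^ i"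
    using True by (intro divide_right_mono) auto
  then show ?thesis
    using True by (simp add: flat_def power_add power2_eq_square del: fact_Suc)
qed (use assms in \<open>simp add: flat_def\<close>)

lemma has_real_derivative_zero_if_le_square:
  fixes f :: "real \<Rightarrow> real"
  assumes "\<And>t. \<bar>f t\<bar> \<le> K * t\<^sup>2"
  shows "(f has_real_derivative 0) (at 0)"
proof -
  have f0: "f 0 = 0"
    using assms[of 0] by simp
  have "((\<lambda>h. f h / h) \<longlongrightarrow> 0) (at 0)"
  proof (rule tendsto_rabs_zero_cancel, rule tendsto_sandwich[where f = "\<lambda>_. 0" and h = "\<lambda>h. K * \<bar>h\<bar>"])
    show "\<forall>\<^sub>F h in at 0. \<bar>f h / h\<bar> \<le> K * \<bar>h\<bar>"
    proof (rule eventually_mono[OF eventually_neq_at_within[of 0]])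
      fix h :: real assume "h \<noteq> 0"
      then show "\<bar>f h / h\<bar> \<le> K * \<bar>h\<bar>"
        using assms[of h] by (simp add: abs_divide divide_le_eq power2_eq_square mult.assoc)
    qed
  qed (auto intro!: tendsto_eq_intros)
  then show ?thesis
    by (simp add: DERIV_def f0)
qed

lemma flat_has_derivative:
  assumes "c > 0"
  shows "(flat c i has_real_derivative c * flat c (i + 2) t - real i * flat c (i + 1) t) (at t)"
proof -
  consider "t < 0" | "t = 0" | "t > 0" by linarith
  then show ?thesis
  proof cases
    case 1
    have "(flat c i has_real_derivative 0) (at t)"
      by (rule has_field_derivative_transform_within_open[of "\<lambda>_. 0" _ _ "{..<0}"])
        (use 1 in \<open>auto simp: flat_def\<close>)
    then show ?thesis using 1 by (simp add: flat_def)
  next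
    case 2
    then show ?thesis
      using has_real_derivative_zero_if_le_square[OF flat_le_square[OF assms], of i]
      by (simp add: flat_def[of _ _ 0])
  next
    case 3
    have "((\<lambda>t. exp (- c / t) / t ^ i) has_real_derivative
            c * flat c (i + 2) t - real i * flat c (i + 1) t) (at t)"
      using 3 by (auto intro!: derivative_eq_intros simp: flat_def field_simps power_add)
         (cases i; simp add: field_simps power2_eq_square)
    then show ?thesis
      by (rule has_field_derivative_transform_within_open[of _ _ _ "{0<..}"])
        (use 3 in \<open>auto simp: flat_def\<close>)
  qed
qed

text \<open>This span is closed under differentiation, which gives smoothness without a Leibniz rule for
  higher derivatives.\<close>

inductive bump_span :: "real \<Rightarrow> real \<Rightarrow> real \<Rightarrow> (real \<Rightarrow> real) \<Rightarrow> bool" for c a b where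
  product: "bump_span c a b (\<lambda>x. k * flat c i (x - a) * flat c j (b - x))"
| add: "bump_span c a b g \<Longrightarrow> bump_span c a b h \<Longrightarrow> bump_span c a b (\<lambda>x. g x + h x)"

lemma bump_span_deriv:
  assumes "c > 0" "bump_span c a b g"
  shows "\<exists>g'. bump_span c a b g' \<and> (\<forall>x. (g has_real_derivative g' x) (at x))"
  using assms(2)
proof induction
  case (product k i j)
  let ?f = "\<lambda>m i j x. m * flat c i (x - a) * flat c j (b - x)"
  let ?g' = "\<lambda>x. (?f (k * c) (i + 2) j x + ?f (- k * real i) (i + 1) j x)
     + (?f (- k * c) i (j + 2) x + ?f (k * real j) i (j + 1) x)"
  have "bump_span c a b ?g'"
    by (intro bump_span.intros)
  moreover have "((\<lambda>x. k * flat c i (x - a) * flat c j (b - x)) has_real_derivative ?g' x) (at x)" for x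
    by (rule derivative_eq_intros DERIV_chain2[OF flat_has_derivative[OF assms(1)]] refl)+
       (simp add: algebra_simps)
  ultimately show ?case by blast
next
  case (add g h)
  then obtain g' h' where "bump_span c a b g'" "\<And>x. (g has_real_derivative g' x) (at x)"
    "bump_span c a b h'" "\<And>x. (h has_real_derivative h' x) (at x)"
    by blast
  then show ?case
    by (intro exI[of _ "\<lambda>x. g' x + h' x"]) (auto intro: bump_span.add DERIV_add)
qed

lemma smooth_on_bump_span:
  assumes "c > 0" "bump_span c a b g"
  shows "smooth_on S g"
proof (rule smooth_on_coinduct[where P = "bump_span c a b"])
  fix g assume g: "bump_span c a b g"
  obtain g' where g': "bump_span c a b g'" "\<And>x. (g has_real_derivative g' x) (at x)"
    using bump_span_deriv[OF assms(1) g] by blast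
  then show "\<forall>x\<in>S. g differentiable (at x)"
    using real_differentiable_def by blast
  have "deriv g = g'"
    using g'(2) DERIV_imp_deriv by blast
  then show "bump_span c a b (deriv g)"
    using g'(1) by simp
qed fact

definition bump :: "real \<Rightarrow> real \<Rightarrow> real \<Rightarrow> real \<Rightarrow> real" where
  "bump c a b x = flat c 0 (x - a) * flat c 0 (b - x)"

lemma test_fun_bump:
  assumes "c > 0" "0 < a"
  shows "test_fun (bump c a b)"
proof -
  have "bump c a b = (\<lambda>x. 1 * flat c 0 (x - a) * flat c 0 (b - x))"
    by (auto simp: bump_def)
  then have "smooth_on UNIV (bump c a b)"
    using smooth_on_bump_span[OF assms(1) bump_span.product[of c a b 1 0 0]] by simp
  moreover have "compact {a..b}" "{a..b} \<subseteq> {0<..}" "\<forall>x. x \<notin> {a..b} \<longrightarrow> bump c a b x = 0"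
    using assms by (auto simp: bump_def flat_def)
  ultimately show ?thesis
    unfolding test_fun_def by blast
qed

lemma bump_pos: "a < x \<Longrightarrow> x < b \<Longrightarrow> bump c a b x > 0"
  by (simp add: bump_def flat_def)

lemma bump_nonneg: "bump c a b x \<ge> 0"
  by (simp add: bump_def flat_def)

lemma bump_outside: "x \<le> a \<or> b \<le> x \<Longrightarrow> bump c a b x = 0"
  by (auto simp add: bump_def flat_def)

lemma bump_le_1: "c > 0 \<Longrightarrow> bump c a b x \<le> 1"
  by (auto simp: bump_def flat_def intro!: mult_le_one)

lemma bump_tendsto_indicator:
  "(\<lambda>n. bump (1 / real (Suc n)) a b x) \<longlonglongrightarrow> indicator {a<..<b} x"
proof (cases "x \<in> {a<..<b}")
  case True
  have "(\<lambda>n. exp (- (1 / real (Suc n)) / (x - a)) * exp (- (1 / real (Suc n)) / (b - x)))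
      \<longlonglongrightarrow> exp (- 0 / (x - a)) * exp (- 0 / (b - x))"
    using True by (intro tendsto_intros lim_1_over_n[THEN LIMSEQ_Suc]) auto
  then show ?thesis
    using True by (simp add: bump_def flat_def)
next
  case False
  then show ?thesis
    by (auto simp: bump_outside not_less)
qed

section \<open>Weak derivatives\<close>

lemma test_funE:
  assumes "test_fun \<phi>"
  obtains a b where "0 < a" "a < b" "\<And>x. x \<le> a \<or> b \<le> x \<Longrightarrow> \<phi> x = 0 \<and> deriv \<phi> x = 0"
proof -
  obtain K where K: "compact K" "K \<subseteq> {0<..}" "\<And>x. x \<notin> K \<Longrightarrow> \<phi> x = 0"
    using assms unfolding test_fun_def by blast
  obtain a b where ab: "0 < a" "a < b" "K \<subseteq> {a<..<b}"
  proof (cases "K = {}")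
    case True
    then show ?thesis using that[of 1 2] by simp
  next
    case False
    obtain m where m: "m \<in> K" "\<And>x. x \<in> K \<Longrightarrow> m \<le> x"
      using compact_attains_inf[OF K(1) False] by blast
    obtain M where M: "M \<in> K" "\<And>x. x \<in> K \<Longrightarrow> x \<le> M"
      using compact_attains_sup[OF K(1) False] by blast
    have "m > 0" "m \<le> M" using m(1) K(2) M(2)[OF m(1)] by auto
    then show ?thesis
      using m(2) M(2) by (intro that[of "m / 2" "M + 1"]) fastforce+
  qed
  have "deriv \<phi> x = 0" if "x \<notin> K" for x
  proof -
    have "(\<phi> has_real_derivative 0) (at x)"
      by (rule has_field_derivative_transform_within_open[of "\<lambda>_. 0" _ _ "- K"])
        (use that K compact_imp_closed in auto)
    then show ?thesis
      by (rule DERIV_imp_deriv)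
  qed
  moreover have "x \<notin> K" if "x \<le> a \<or> b \<le> x" for x
    using that ab(3) by fastforce
  ultimately show ?thesis
    using that[OF ab(1,2)] K(3) by blast
qed

lemma set_lebesgue_integral_eq_integral_Icc:
  fixes h :: "real \<Rightarrow> real"
  assumes "{a..b} \<subseteq> S" "\<And>x. x \<in> S \<Longrightarrow> x \<notin> {a..b} \<Longrightarrow> h x = 0" "continuous_on {a..b} h"
  shows "(LINT x:S|lebesgue. h x) = integral {a..b} h"
proof -
  have "(LINT x:S|lebesgue. h x) = (LINT x:{a..b}|lebesgue. h x)"
    unfolding set_lebesgue_integral_def
    using assms(1,2) by (intro Bochner_Integration.integral_cong) (auto simp: indicator_def)
  also have "\<dots> = integral {a..b} h"
    using assms(3) by (intro set_lebesgue_integral_eq_integral absolutely_integrable_continuous_real)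
  finally show ?thesis .
qed

lemma Lp_loc_continuous:
  assumes "continuous_on {0<..} g" "p > 0"
  shows "Lp_loc p g"
  unfolding Lp_loc_def
proof (intro conjI allI impI)
  show "g \<in> borel_measurable (lebesgue_on {0<..})"
    using assms(1) by (intro continuous_imp_measurable_on_sets_lebesgue) auto
  fix K :: "real set" assume K: "compact K \<and> K \<subseteq> {0<..}"
  have "continuous_on K (\<lambda>x. \<bar>g x\<bar> powr p)"
    using assms(2) continuous_on_subset[OF assms(1)] K
    by (intro continuous_on_powr' continuous_intros) auto
  then have "integrable lborel (\<lambda>x. indicator K x *\<^sub>R \<bar>g x\<bar> powr p)"
    using K by (intro borel_integrable_compact) auto
  then have "integrable lebesgue (\<lambda>x. indicator K x *\<^sub>R \<bar>g x\<bar> powr p)"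
    by (metis integrable_completion borel_measurable_integrable)
  moreover have "K \<in> sets lebesgue"
    using K by (auto intro: fmeasurableD lmeasurable_compact)
  ultimately show "integrable (lebesgue_on K) (\<lambda>x. \<bar>g x\<bar> powr p)"
    by (simp add: integrable_restrict_space)
qed

lemma has_weak_deriv_classical:
  assumes d: "\<And>x. x > 0 \<Longrightarrow> (g has_real_derivative g' x) (at x)" and c: "continuous_on {0<..} g'"
  shows "has_weak_deriv g g'"
  unfolding has_weak_deriv_def
proof (intro conjI allI impI)
  have cg: "continuous_on {0<..} g"
    using d by (intro continuous_at_imp_continuous_on) (auto dest: DERIV_isCont)
  show "Lp_loc 1 g" "Lp_loc 1 g'"
    using Lp_loc_continuous[OF cg] Lp_loc_continuous[OF c] by auto
  fix \<phi> assume \<phi>: "test_fun \<phi>"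
  obtain a b where ab: "0 < a" "a < b" "\<And>x. x \<le> a \<or> b \<le> x \<Longrightarrow> \<phi> x = 0 \<and> deriv \<phi> x = 0"
    using test_funE[OF \<phi>] by blast
  have sm: "smooth_on UNIV \<phi>" using \<phi> by (simp add: test_fun_def)
  have d\<phi>: "(\<phi> has_real_derivative deriv \<phi> x) (at x)" for x
    using smooth_onD(1)[OF sm] by simp
  have c\<phi>: "continuous_on A \<phi>" "continuous_on A (deriv \<phi>)" for A
    using smooth_on_continuous_on[OF sm] smooth_on_continuous_on[OF smooth_onD(2)[OF sm]]
      continuous_on_subset by blast+
  have sub: "{a..b} \<subseteq> {0<..}" using ab by auto
  note cg' = continuous_on_subset[OF cg sub] continuous_on_subset[OF c sub]
  have "((\<lambda>x. g' x * \<phi> x + g x * deriv \<phi> x) has_integral (g b * \<phi> b - g a * \<phi> a)) {a..b}"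
  proof (rule fundamental_theorem_of_calculus)
    fix x assume "x \<in> {a..b}"
    then have "((\<lambda>x. g x * \<phi> x) has_real_derivative (g' x * \<phi> x + g x * deriv \<phi> x)) (at x)"
      using ab by (auto intro!: derivative_eq_intros d d\<phi>)
    then show "((\<lambda>x. g x * \<phi> x) has_vector_derivative g' x * \<phi> x + g x * deriv \<phi> x) (at x within {a..b})"
      using has_real_derivative_iff_has_vector_derivative has_vector_derivative_at_within by blast
  qed (use ab in auto)
  then have "integral {a..b} (\<lambda>x. g' x * \<phi> x + g x * deriv \<phi> x) = 0"
    using ab by (simp add: integral_unique)
  moreover have "integral {a..b} (\<lambda>x. g' x * \<phi> x + g x * deriv \<phi> x)
      = integral {a..b} (\<lambda>x. g' x * \<phi> x) + integral {a..b} (\<lambda>x. g x * deriv \<phi> x)"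
    by (intro Henstock_Kurzweil_Integration.integral_add integrable_continuous_interval
        continuous_on_mult cg' c\<phi>)
  moreover have "(LINT x:{0<..}|lebesgue. g x * deriv \<phi> x) = integral {a..b} (\<lambda>x. g x * deriv \<phi> x)"
    by (intro set_lebesgue_integral_eq_integral_Icc continuous_on_mult cg' c\<phi> sub) (use ab in auto)
  moreover have "(LINT x:{0<..}|lebesgue. g' x * \<phi> x) = integral {a..b} (\<lambda>x. g' x * \<phi> x)"
    by (intro set_lebesgue_integral_eq_integral_Icc continuous_on_mult cg' c\<phi> sub) (use ab in auto)
  ultimately show "(LINT x:{0<..}|lebesgue. g x * deriv \<phi> x) = - (LINT x:{0<..}|lebesgue. g' x * \<phi> x)"
    by linarith
qed

lemma set_integrable_Lp_loc_1:
  assumes "Lp_loc 1 g" "0 < a"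
  shows "set_integrable lebesgue {a..b} g"
proof -
  have sub: "{a..b} \<subseteq> {0<..}" using assms by auto
  have "integrable (lebesgue_on {a..b}) (\<lambda>x. norm (g x))"
    using assms sub unfolding Lp_loc_def by (auto dest!: spec[of _ "{a..b}"])
  moreover have "g \<in> borel_measurable (lebesgue_on {a..b})"
    using assms sub unfolding Lp_loc_def by (auto intro: measurable_restrict_mono)
  ultimately have "integrable (lebesgue_on {a..b}) g"
    using integrable_norm_iff by blast
  then show ?thesis
    by (simp add: set_integrable_def integrable_restrict_space)
qed

lemma integral_zero_if_weak_zero:
  assumes d: "Lp_loc 1 d" and z: "\<And>\<phi>. test_fun \<phi> \<Longrightarrow> (LINT x:{0<..}|lebesgue. d x * \<phi> x) = 0"
    and a: "0 < a"
  shows "integral {a..b} d = 0"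
proof -
  let ?\<phi> = "\<lambda>n. bump (1 / real (Suc n)) a b"
  note di = set_integrable_Lp_loc_1[OF d a, of b]
  have "(\<lambda>n. LINT x|lebesgue. indicator {0<..} x *\<^sub>R (d x * ?\<phi> n x))
      \<longlonglongrightarrow> (LINT x|lebesgue. indicator {a<..<b} x * (indicator {a..b} x * d x))"
  proof (rule integral_dominated_convergence[where w = "\<lambda>x. norm (indicator {a..b} x * d x)"])
    have dm: "(\<lambda>x. indicator {a..b} x * d x) \<in> borel_measurable lebesgue"
      using di by (auto simp: set_integrable_def dest: borel_measurable_integrable)
    have bm: "?\<phi> n \<in> borel_measurable lebesgue" for n
    proof -
      have "smooth_on UNIV (?\<phi> n)"
        using test_fun_bump[of "1 / real (Suc n)" a b] a by (simp add: test_fun_def)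
      from smooth_on_continuous_on[OF this]
      have "?\<phi> n \<in> borel_measurable borel"
        using borel_measurable_continuous_onI by blast
      then show ?thesis
        by (intro measurable_completion) simp
    qed
    have eq: "indicator {0<..} x *\<^sub>R (d x * ?\<phi> n x) = indicator {a..b} x * d x * ?\<phi> n x" for n x
      using a by (auto simp: indicator_def bump_outside not_le)
    show "(\<lambda>x. indicator {a<..<b} x * (indicator {a..b} x * d x)) \<in> borel_measurable lebesgue"
      by (intro borel_measurable_times dm borel_measurable_indicator) auto
    show "(\<lambda>x. indicator {0<..} x *\<^sub>R (d x * ?\<phi> n x)) \<in> borel_measurable lebesgue" for n
      unfolding eq by (intro borel_measurable_times dm bm)
    show "integrable lebesgue (\<lambda>x. norm (indicator {a..b} x * d x))"
      using di by (simp add: set_integrable_def)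
    show "AE x in lebesgue. (\<lambda>n. indicator {0<..} x *\<^sub>R (d x * ?\<phi> n x))
        \<longlonglongrightarrow> indicator {a<..<b} x * (indicator {a..b} x * d x)"
      unfolding eq
      by (intro AE_I2) (subst mult.commute, intro tendsto_mult_right bump_tendsto_indicator)
    show "AE x in lebesgue. norm (indicator {0<..} x *\<^sub>R (d x * ?\<phi> n x)) \<le> norm (indicator {a..b} x * d x)" for n
      unfolding eq
      using bump_le_1[of "1 / real (Suc n)" a b] bump_nonneg[of "1 / real (Suc n)" a b]
      by (intro AE_I2) (simp add: abs_mult mult_left_le)
  qed
  moreover have "(LINT x|lebesgue. indicator {0<..} x *\<^sub>R (d x * ?\<phi> n x)) = 0" for n
    using z[OF test_fun_bump[OF _ a, of "1 / real (Suc n)"]] by (simp add: set_lebesgue_integral_def)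
  ultimately have "(LINT x|lebesgue. indicator {a<..<b} x * (indicator {a..b} x * d x)) = 0"
    by (simp add: LIMSEQ_const_iff)
  moreover have "(LINT x|lebesgue. indicator {a<..<b} x * (indicator {a..b} x * d x))
      = (LINT x|lebesgue. indicator {a<..<b} x *\<^sub>R d x)"
    by (intro Bochner_Integration.integral_cong) (auto simp: indicator_def)
  ultimately have 0: "(LINT x:{a<..<b}|lebesgue. d x) = 0"
    by (simp add: set_lebesgue_integral_def)
  have "set_integrable lebesgue {a<..<b} d"
    by (rule set_integrable_subset[OF di]) auto
  from set_lebesgue_integral_eq_integral(2)[OF this] 0
  show ?thesis
    by (simp add: integral_open_interval_real)
qed

lemma weak_zero_imp_AE_zero:
  assumes d: "Lp_loc 1 d" and z: "\<And>\<phi>. test_fun \<phi> \<Longrightarrow> (LINT x:{0<..}|lebesgue. d x * \<phi> x) = 0"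
  shows "AE x in lebesgue. x > 0 \<longrightarrow> d x = 0"
proof -
  define I where "I k = {1 / real (Suc k)..real k}" for k
  define D where "D k x = (if x \<in> I k then d x else 0)" for k x
  have "\<exists>N. negligible N \<and> (\<forall>x\<in>interior (I k) - N. d x = 0)" for k
  proof -
    have "set_integrable lebesgue (I k) d"
      unfolding I_def by (intro set_integrable_Lp_loc_1 d) auto
    then have "d integrable_on I k"
      by (rule set_lebesgue_integral_eq_integral)
    then have "D k integrable_on UNIV"
      unfolding D_def by (simp add: integrable_restrict_UNIV)
    then have "D k integrable_on cbox a b" for a b
      by (rule integrable_on_subcbox) auto
    then obtain N where N: "negligible N"
       "\<And>x e. \<lbrakk>x \<notin> N; 0 < e\<rbrakk> \<Longrightarrow> \<exists>\<delta>>0. \<forall>h. 0 < h \<and> h < \<delta> \<longrightarrow>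
          norm (integral (cbox x (x + h *\<^sub>R One)) (D k) /\<^sub>R h ^ DIM(real) - D k x) < e"
      using integrable_ccontinuous_explicit by blast
    have "d x = 0" if x: "x \<in> interior (I k) - N" for x
    proof (rule ccontr)
      assume nz: "d x \<noteq> 0"
      have xi: "1 / real (Suc k) < x" "x < real k"
        using x by (auto simp: I_def interior_atLeastAtMost_real)
      have x0: "0 < x" using xi(1) by (metis less_trans of_nat_0_less_iff zero_less_Suc zero_less_divide_1_iff)
      obtain \<delta> where \<delta>: "\<delta> > 0" "\<And>h. 0 < h \<Longrightarrow> h < \<delta> \<Longrightarrow>
          norm (integral (cbox x (x + h *\<^sub>R One)) (D k) /\<^sub>R h ^ DIM(real) - D k x) < \<bar>d x\<bar>"
        using N(2)[of x "\<bar>d x\<bar>"] x nz by auto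
      define h where "h = min (\<delta> / 2) (real k - x)"
      have h: "0 < h" "h < \<delta>" "x + h \<le> real k"
        using \<delta>(1) xi by (auto simp: h_def)
      have "integral {x..x+h} (D k) = integral {x..x+h} d"
        by (intro Henstock_Kurzweil_Integration.integral_cong) (use xi h in \<open>auto simp: D_def I_def\<close>)
      also have "\<dots> = 0"
        by (rule integral_zero_if_weak_zero[OF d z x0])
      finally show False
        using \<delta>(2)[OF h(1,2)] xi by (simp add: D_def I_def)
    qed
    then show ?thesis using N(1) by blast
  qed
  then obtain N where N: "\<And>k. negligible (N k)" "\<And>k x. x \<in> interior (I k) - N k \<Longrightarrow> d x = 0"
    by metis
  have "negligible (\<Union>k. N k)"
    using N(1) by (intro negligible_countable_Union) auto
  then have "AE x in lebesgue. x \<notin> (\<Union>k. N k)"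
    unfolding negligible_iff_null_sets by (rule AE_not_in)
  then show ?thesis
  proof (rule eventually_mono, intro impI)
    fix x assume x: "x \<notin> (\<Union>k. N k)" "x > 0"
    obtain k1 where k1: "1 / real (Suc k1) < x"
      using reals_Archimedean[OF x(2)] by (auto simp: inverse_eq_divide)
    obtain k2 where k2: "x < real k2"
      using reals_Archimedean2 by blast
    define k where "k = max k1 k2"
    have "1 / real (Suc k) \<le> 1 / real (Suc k1)" "real k2 \<le> real k"
      unfolding k_def by (auto simp: divide_simps)
    then have "x \<in> interior (I k)"
      using k1 k2 by (auto simp: I_def interior_atLeastAtMost_real)
    then show "d x = 0"
      using N(2) x by blast
  qed
qed

lemma Lp_loc_1_diff:
  assumes "Lp_loc 1 g" "Lp_loc 1 h"
  shows "Lp_loc 1 (\<lambda>x. g x - h x)"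
  unfolding Lp_loc_def
proof (intro conjI allI impI)
  show "(\<lambda>x. g x - h x) \<in> borel_measurable (lebesgue_on {0<..})"
    using assms by (auto simp: Lp_loc_def)
  fix K :: "real set" assume K: "compact K \<and> K \<subseteq> {0<..}"
  have *: "integrable (lebesgue_on K) g" if "Lp_loc 1 g" for g
  proof -
    have "g \<in> borel_measurable (lebesgue_on K)"
      using that K by (auto simp: Lp_loc_def intro: measurable_restrict_mono)
    moreover have "integrable (lebesgue_on K) (\<lambda>x. norm (g x))"
      using that K by (auto simp: Lp_loc_def)
    ultimately show ?thesis
      using integrable_norm_iff by blast
  qed
  show "integrable (lebesgue_on K) (\<lambda>x. \<bar>g x - h x\<bar> powr 1)"
    using *[OF assms(1)] *[OF assms(2)] by simp
qed

lemma set_integrable_mult_test_fun: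
  assumes "Lp_loc 1 g" "test_fun \<phi>"
  shows "set_integrable lebesgue {0<..} (\<lambda>x. g x * \<phi> x)"
proof -
  obtain a b where ab: "0 < a" "a < b" "\<And>x. x \<le> a \<or> b \<le> x \<Longrightarrow> \<phi> x = 0 \<and> deriv \<phi> x = 0"
    using test_funE[OF assms(2)] by blast
  have c: "continuous_on {a..b} \<phi>"
    using assms(2) smooth_on_continuous_on continuous_on_subset unfolding test_fun_def by blast
  have "(\<lambda>x. \<phi> x * g x) absolutely_integrable_on {a..b}"
  proof (rule absolutely_integrable_bounded_measurable_product_real)
    show "\<phi> \<in> borel_measurable (lebesgue_on {a..b})"
      using c by (intro continuous_imp_measurable_on_sets_lebesgue) auto
    show "bounded (\<phi> ` {a..b})"
      using compact_continuous_image[OF c] compact_imp_bounded by blast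
    show "g absolutely_integrable_on {a..b}"
      by (rule set_integrable_Lp_loc_1[OF assms(1) ab(1)])
  qed auto
  moreover have "indicator {0<..} x *\<^sub>R (g x * \<phi> x) = indicator {a..b} x *\<^sub>R (\<phi> x * g x)" for x
    using ab(1) ab(3)[of x] by (auto simp: indicator_def)
  ultimately show ?thesis
    by (simp add: set_integrable_def del: real_scaleR_def)
qed

lemma has_weak_deriv_unique:
  assumes "has_weak_deriv f g" "has_weak_deriv f h"
  shows "AE x in lebesgue. x > 0 \<longrightarrow> g x = h x"
proof -
  have loc: "Lp_loc 1 g" "Lp_loc 1 h"
    using assms by (auto simp: has_weak_deriv_def)
  have "(LINT x:{0<..}|lebesgue. (g x - h x) * \<phi> x) = 0" if \<phi>: "test_fun \<phi>" for \<phi>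
  proof -
    have "(LINT x:{0<..}|lebesgue. g x * \<phi> x - h x * \<phi> x)
        = (LINT x:{0<..}|lebesgue. g x * \<phi> x) - (LINT x:{0<..}|lebesgue. h x * \<phi> x)"
      using set_integrable_mult_test_fun[OF loc(1) \<phi>] set_integrable_mult_test_fun[OF loc(2) \<phi>]
      by (rule set_integral_diff)
    then show ?thesis
      using assms \<phi> unfolding has_weak_deriv_def by (simp add: left_diff_distrib)
  qed
  from weak_zero_imp_AE_zero[OF Lp_loc_1_diff[OF loc] this] show ?thesis by simp
qed

lemma weak_deriv_AE_eq:
  assumes "\<And>x. x > 0 \<Longrightarrow> (g has_real_derivative g' x) (at x)" "continuous_on {0<..} g'"
  shows "AE x in lebesgue. x > 0 \<longrightarrow> weak_deriv g x = g' x"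
proof -
  have *: "has_weak_deriv g g'"
    by (rule has_weak_deriv_classical[OF assms])
  then have "has_weak_deriv g (weak_deriv g)"
    unfolding weak_deriv_def by (rule someI[of "has_weak_deriv g"])
  from has_weak_deriv_unique[OF this *] show ?thesis .
qed

section \<open>The energy\<close>

definition lagr :: "real \<Rightarrow> real \<Rightarrow> real \<Rightarrow> real \<Rightarrow> real" where
  "lagr p r y y' = ((y'\<^sup>2 + y\<^sup>2 / r\<^sup>2) powr (p/2) + 1/2 * (1 - y\<^sup>2)\<^sup>2) * r"

definition C1_pos :: "(real \<Rightarrow> real) \<Rightarrow> (real \<Rightarrow> real) \<Rightarrow> bool" where
  "C1_pos g g' \<longleftrightarrow> (\<forall>x>0. (g has_real_derivative g' x) (at x)) \<and> continuous_on {0<..} g'"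

lemma C1_posD:
  assumes "C1_pos g g'"
  shows "\<And>x. x > 0 \<Longrightarrow> (g has_real_derivative g' x) (at x)" "continuous_on {0<..} g'" "continuous_on {0<..} g"
  using assms unfolding C1_pos_def
  by (auto intro!: continuous_at_imp_continuous_on dest: DERIV_isCont)

lemma lagr_nonneg: "r > 0 \<Longrightarrow> lagr p r y y' \<ge> 0"
  by (auto simp: lagr_def)

lemma continuous_on_lagr:
  assumes "C1_pos g g'" "p > 2"
  shows "continuous_on {0<..} (\<lambda>r. lagr p r (g r) (g' r))"
  unfolding lagr_def using assms(2)
  by (intro continuous_intros continuous_on_powr' C1_posD[OF assms(1)]) auto

lemma I_energy_classical:
  assumes "C1_pos g g'"
  shows "I_energy p g = (\<integral>\<^sup>+r\<in>{0<..}. ennreal (lagr p r (g r) (g' r)) \<partial>lborel)"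
proof -
  have "I_energy p g = (\<integral>\<^sup>+r\<in>{0<..}. ennreal (lagr p r (g r) (g' r)) \<partial>lebesgue)"
    unfolding I_energy_def lagr_def
    by (rule nn_integral_cong_AE, rule eventually_mono[OF weak_deriv_AE_eq[OF C1_posD(1,2)[OF assms]]])
      (auto simp: indicator_def)
  then show ?thesis
    by (simp add: nn_integral_completion)
qed

lemma X_space_classical:
  assumes "C1_pos g g'" "p > 2" "I_energy p g < \<infinity>"
  shows "g \<in> X_space p"
proof -
  have "Lp_loc p g" "Lp_loc p g'" "has_weak_deriv g g'"
    using Lp_loc_continuous has_weak_deriv_classical C1_posD[OF assms(1)] assms(2) by auto
  then have "g \<in> W1p_loc p"
    unfolding W1p_loc_def by blast
  moreover have "(\<integral>\<^sup>+r\<in>{0<..}. ennreal ((\<bar>weak_deriv g r\<bar>\<^sup>2 + (g r)\<^sup>2 / r\<^sup>2) powr (p/2) * r) \<partial>lebesgue) \<le> I_energy p g"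
    unfolding I_energy_def
    by (intro nn_integral_mono) (auto simp: indicator_def intro!: ennreal_leI mult_right_mono)
  ultimately show ?thesis
    using assms(3) unfolding X_space_def by (auto intro: le_less_trans)
qed

lemma nn_integral_Icc_eq_integral:
  fixes h :: "real \<Rightarrow> real"
  assumes "continuous_on {a..b} h" "\<And>x. x \<in> {a..b} \<Longrightarrow> h x \<ge> 0"
  shows "(\<integral>\<^sup>+x\<in>{a..b}. ennreal (h x) \<partial>lborel) = ennreal (integral {a..b} h)"
proof -
  have "(h has_integral integral {a..b} h) {a..b}"
    using assms(1) by (intro integrable_integral integrable_continuous_interval)
  then have "(\<integral>\<^sup>+x. ennreal (indicator {a..b} x * h x) \<partial>lborel) = ennreal (integral {a..b} h)"
    using assms(2) by (intro nn_integral_has_integral_lebesgue) auto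
  moreover have "ennreal (indicator {a..b} x * h x) = ennreal (h x) * indicator {a..b} x" for x
    by (auto simp: indicator_def)
  ultimately show ?thesis by simp
qed

lemma finite_energy_competitor:
  assumes "p > 2"
  shows "\<exists>g\<in>X_space p. I_energy p g < \<infinity>"
proof -
  define g where "g x = x / sqrt (1 + x\<^sup>2)" for x :: real
  define g' where "g' x = 1 / ((1 + x\<^sup>2) * sqrt (1 + x\<^sup>2))" for x :: real
  have pos: "1 + x\<^sup>2 > 0" for x :: real
    by (simp add: add_pos_nonneg)
  have "(g has_real_derivative g' x) (at x)" for x
  proof -
    have "(g has_real_derivative (1 * sqrt (1 + x\<^sup>2) - x * (2 * x * (inverse (sqrt (1 + x\<^sup>2)) / 2))) / (sqrt (1 + x\<^sup>2) * sqrt (1 + x\<^sup>2))) (at x)"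
      unfolding g_def using pos[of x] by (auto intro!: derivative_eq_intros)
    also have "(1 * sqrt (1 + x\<^sup>2) - x * (2 * x * (inverse (sqrt (1 + x\<^sup>2)) / 2))) / (sqrt (1 + x\<^sup>2) * sqrt (1 + x\<^sup>2)) = g' x"
    proof -
      define s where "s = sqrt (1 + x\<^sup>2)"
      have s: "s > 0" "s * s = 1 + x\<^sup>2"
        using pos[of x] by (auto simp: s_def)
      have "s - x * (2 * x * (inverse s / 2)) = (s * s - x\<^sup>2) / s"
        using s(1) by (simp add: field_simps power2_eq_square)
      then show ?thesis
        unfolding g'_def s_def[symmetric] using s by (simp add: field_simps)
    qed
    finally show ?thesis .
  qed
  moreover have "continuous_on {0<..} g'"
    unfolding g'_def using pos by (intro continuous_intros) (auto simp: less_imp_neq[symmetric])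
  ultimately have C1: "C1_pos g g'"
    by (simp add: C1_pos_def)
  define h where "h x = x * (2 powr (p/2) * (1 + x\<^sup>2) powr (- (p/2))) + x / (2 * (1 + x\<^sup>2)\<^sup>2)" for x :: real
  define H where "H x = - (2 powr (p/2) * (1 + x\<^sup>2) powr (1 - p/2) / (p - 2)) - 1 / (4 * (1 + x\<^sup>2))" for x :: real
  have le: "lagr p r (g r) (g' r) \<le> h r" if "r > 0" for r
  proof -
    have g2: "(g r)\<^sup>2 = r\<^sup>2 / (1 + r\<^sup>2)" "(g' r)\<^sup>2 = 1 / (1 + r\<^sup>2)^3"
      using pos[of r] by (auto simp: g_def g'_def power_divide power_mult_distrib power3_eq_cube power2_eq_square)
    have "1 - (g r)\<^sup>2 = 1 / (1 + r\<^sup>2)"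
      using pos[of r] by (simp add: g2 field_simps)
    then have e: "1/2 * (1 - (g r)\<^sup>2)\<^sup>2 = 1 / (2 * (1 + r\<^sup>2)\<^sup>2)"
      by (simp add: power_divide)
    have "1 / (1 + r\<^sup>2)^3 \<le> 1 / (1 + r\<^sup>2)^1"
      using pos[of r] by (intro divide_left_mono power_increasing mult_pos_pos zero_less_power) auto
    moreover have "(g r)\<^sup>2 / r\<^sup>2 = inverse (1 + r\<^sup>2)"
      using that by (simp add: g2 inverse_eq_divide)
    ultimately have "(g' r)\<^sup>2 + (g r)\<^sup>2 / r\<^sup>2 \<le> 2 * inverse (1 + r\<^sup>2)"
      by (simp add: g2(2) inverse_eq_divide)
    then have "((g' r)\<^sup>2 + (g r)\<^sup>2 / r\<^sup>2) powr (p/2) \<le> (2 * inverse (1 + r\<^sup>2)) powr (p/2)"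
      using assms by (intro powr_mono2) auto
    also have "\<dots> = 2 powr (p/2) * (1 + r\<^sup>2) powr (- (p/2))"
      using pos[of r] by (simp add: powr_mult powr_minus inverse_powr)
    finally show ?thesis
      unfolding lagr_def h_def e using that by (simp add: algebra_simps)
  qed
  have "(\<integral>\<^sup>+r\<in>{0<..}. ennreal (lagr p r (g r) (g' r)) \<partial>lborel) \<le> (\<integral>\<^sup>+r. ennreal (h r) * indicator {0..} r \<partial>lborel)"
    using le by (intro nn_integral_mono) (auto simp: indicator_def intro!: ennreal_leI)
  also have "\<dots> = ennreal (0 - H 0)"
  proof (rule nn_integral_FTC_atLeast)
    show "h \<in> borel_measurable borel"
      unfolding h_def by measurable
    show "(H has_real_derivative h x) (at x)" if "x \<ge> 0" for x
    proof -
      have d1: "((\<lambda>x. (1 + x\<^sup>2) powr (1 - p/2)) has_real_derivative (1 - p/2) * (1 + x\<^sup>2) powr (1 - p/2 - 1) * (2 * x)) (at x)"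
        using DERIV_fun_powr[of "\<lambda>x. 1 + x\<^sup>2" "2 * x" x "1 - p/2"] pos[of x]
        by (auto intro!: derivative_eq_intros)
      have d2: "((\<lambda>x. 1 / (4 * (1 + x\<^sup>2))) has_real_derivative - (2 * x / (4 * (1 + x\<^sup>2)\<^sup>2))) (at x)"
        using pos[of x] by (auto intro!: derivative_eq_intros simp: power2_eq_square divide_simps)
          (simp add: algebra_simps)
      have H': "(H has_real_derivative - (2 powr (p/2) * ((1 - p/2) * (1 + x\<^sup>2) powr (1 - p/2 - 1) * (2 * x)) / (p - 2)) - - (2 * x / (4 * (1 + x\<^sup>2)\<^sup>2))) (at x)"
        unfolding H_def by (intro DERIV_diff DERIV_minus DERIV_cdivide DERIV_cmult d1 d2)
      have "(1 - p/2) * (2 * x) / (p - 2) = - x"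
        using assms by (simp add: field_simps)
      moreover have "2 powr (p/2) * ((1 - p/2) * (1 + x\<^sup>2) powr (1 - p/2 - 1) * (2 * x)) / (p - 2)
          = 2 powr (p/2) * (1 + x\<^sup>2) powr (1 - p/2 - 1) * ((1 - p/2) * (2 * x) / (p - 2))"
        by (simp add: mult_ac)
      ultimately have "2 powr (p/2) * ((1 - p/2) * (1 + x\<^sup>2) powr (1 - p/2 - 1) * (2 * x)) / (p - 2)
          = 2 powr (p/2) * (1 + x\<^sup>2) powr (1 - p/2 - 1) * (- x)"
        by simp
      then have "- (2 powr (p/2) * ((1 - p/2) * (1 + x\<^sup>2) powr (1 - p/2 - 1) * (2 * x)) / (p - 2)) - - (2 * x / (4 * (1 + x\<^sup>2)\<^sup>2)) = h x"
        unfolding h_def by simp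
      with H' show ?thesis by simp
    qed
    show "0 \<le> h x" if "0 \<le> x" for x
      using that by (simp add: h_def)
    have "filterlim (\<lambda>x::real. 1 + x\<^sup>2) at_top at_top"
      by (intro filterlim_tendsto_add_at_top[OF tendsto_const] filterlim_pow_at_top filterlim_ident) auto
    then have "((\<lambda>x::real. (1 + x\<^sup>2) powr (1 - p/2)) \<longlongrightarrow> 0) at_top" "((\<lambda>x::real. inverse (1 + x\<^sup>2)) \<longlongrightarrow> 0) at_top"
      using assms by (auto intro!: tendsto_neg_powr tendsto_inverse_0_at_top)
    then have "((\<lambda>x. - (2 powr (p/2) * (1 + x\<^sup>2) powr (1 - p/2) / (p - 2)) - inverse (1 + x\<^sup>2) / 4)
        \<longlongrightarrow> - (2 powr (p/2) * 0 / (p - 2)) - 0 / 4) at_top"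
      using assms by (intro tendsto_intros) auto
    then show "(H \<longlongrightarrow> 0) at_top"
      unfolding H_def by (simp add: inverse_eq_divide mult.commute)
  qed
  finally have "I_energy p g < \<infinity>"
    unfolding I_energy_classical[OF C1] by (auto simp: le_less_trans top_unique)
  then show ?thesis
    using X_space_classical[OF C1 assms] by blast
qed

lemma C1_pos_smooth:
  assumes "smooth_on {0<..} f"
  shows "C1_pos f (deriv f)"
  using smooth_onD[OF assms] smooth_on_continuous_on[OF smooth_onD(2)[OF assms]]
  by (auto simp: C1_pos_def)

lemma minimizer_finite_energy:
  assumes "p > 2" "nonneg_minimizer p f" "C1_pos f f'"
  shows "(\<integral>\<^sup>+r\<in>{0<..}. ennreal (lagr p r (f r) (f' r)) \<partial>lborel) < \<infinity>"
proof -
  obtain g where "g \<in> X_space p" "I_energy p g < \<infinity>"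
    using finite_energy_competitor[OF assms(1)] by blast
  then show ?thesis
    using assms(2) unfolding nonneg_minimizer_def I_energy_classical[OF assms(3), symmetric]
    by (meson le_less_trans)
qed

lemma minimizer_local:
  assumes p: "p > 2" and f: "nonneg_minimizer p f" "C1_pos f f'"
    and g: "C1_pos g g'" and c: "0 < c" and
    eq: "\<And>x. x \<notin> {c..d} \<Longrightarrow> g x = f x \<and> g' x = f' x"
  shows "integral {c..d} (\<lambda>r. lagr p r (f r) (f' r)) \<le> integral {c..d} (\<lambda>r. lagr p r (g r) (g' r))"
proof -
  let ?B = "{0<..} - {c..d}"
  have sub: "{c..d} \<subseteq> {0<..}" using c by auto
  have split: "I_energy p h = ennreal (integral {c..d} (\<lambda>r. lagr p r (h r) (h' r)))
      + (\<integral>\<^sup>+r\<in>?B. ennreal (lagr p r (h r) (h' r)) \<partial>lborel)"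
    if h: "C1_pos h h'" for h h'
  proof -
    have cont: "continuous_on {0<..} (\<lambda>r. lagr p r (h r) (h' r))"
      by (rule continuous_on_lagr[OF h p])
    have eq: "{0<..} = {c..d} \<union> ?B" using sub by auto
    have m: "(\<lambda>r. ennreal (lagr p r (h r) (h' r)) * indicator {0<..} r) \<in> borel_measurable lborel"
    proof -
      have "(\<lambda>r. indicator {0<..} r *\<^sub>R lagr p r (h r) (h' r)) \<in> borel_measurable lborel"
        using borel_measurable_continuous_on_indicator[OF _ cont] by simp
      then have "(\<lambda>r. ennreal (indicator {0<..} r *\<^sub>R lagr p r (h r) (h' r))) \<in> borel_measurable lborel"
        by measurable
      moreover have "ennreal (indicator {0<..} r *\<^sub>R lagr p r (h r) (h' r)) = ennreal (lagr p r (h r) (h' r)) * indicator {0<..} r" for r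
        by (auto simp: indicator_def)
      ultimately show ?thesis by simp
    qed
    have "I_energy p h = (\<integral>\<^sup>+r. (ennreal (lagr p r (h r) (h' r)) * indicator {0<..} r) * indicator {c..d} r
        + (ennreal (lagr p r (h r) (h' r)) * indicator {0<..} r) * indicator ?B r \<partial>lborel)"
      unfolding I_energy_classical[OF h]
      by (intro nn_integral_cong) (use sub in \<open>auto simp: indicator_def\<close>)
    also have "\<dots> = (\<integral>\<^sup>+r. (ennreal (lagr p r (h r) (h' r)) * indicator {0<..} r) * indicator {c..d} r \<partial>lborel)
        + (\<integral>\<^sup>+r. (ennreal (lagr p r (h r) (h' r)) * indicator {0<..} r) * indicator ?B r \<partial>lborel)"
      by (intro nn_integral_add borel_measurable_times_ennreal m) auto
    also have "(\<integral>\<^sup>+r. (ennreal (lagr p r (h r) (h' r)) * indicator {0<..} r) * indicator {c..d} r \<partial>lborel)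
        = (\<integral>\<^sup>+r\<in>{c..d}. ennreal (lagr p r (h r) (h' r)) \<partial>lborel)"
      by (intro nn_integral_cong) (use sub in \<open>auto simp: indicator_def\<close>)
    also have "\<dots> = ennreal (integral {c..d} (\<lambda>r. lagr p r (h r) (h' r)))"
      using continuous_on_subset[OF cont sub] sub
      by (intro nn_integral_Icc_eq_integral lagr_nonneg) auto
    also have "(\<integral>\<^sup>+r. (ennreal (lagr p r (h r) (h' r)) * indicator {0<..} r) * indicator ?B r \<partial>lborel)
        = (\<integral>\<^sup>+r\<in>?B. ennreal (lagr p r (h r) (h' r)) \<partial>lborel)"
      by (intro nn_integral_cong) (auto simp: indicator_def)
    finally show ?thesis .
  qed
  have rest: "(\<integral>\<^sup>+r\<in>?B. ennreal (lagr p r (g r) (g' r)) \<partial>lborel)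
      = (\<integral>\<^sup>+r\<in>?B. ennreal (lagr p r (f r) (f' r)) \<partial>lborel)" (is "_ = ?R")
    by (intro nn_integral_cong) (use eq in \<open>auto simp: indicator_def\<close>)
  have "I_energy p f < \<infinity>"
    using minimizer_finite_energy[OF p f] unfolding I_energy_classical[OF f(2)] .
  then have R: "?R < \<infinity>"
    unfolding split[OF f(2)] by (simp add: less_top[symmetric])
  then have "I_energy p g < \<infinity>"
    unfolding split[OF g] rest by (simp add: less_top[symmetric])
  then have "I_energy p f \<le> I_energy p g"
    using f(1) X_space_classical[OF g p] by (simp add: nonneg_minimizer_def)
  then have "ennreal (integral {c..d} (\<lambda>r. lagr p r (f r) (f' r))) \<le> ennreal (integral {c..d} (\<lambda>r. lagr p r (g r) (g' r)))"
    unfolding split[OF f(2)] split[OF g] rest using R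
    by (subst (asm) (1 2) add.commute) (auto simp: ennreal_add_left_cancel_le)
  moreover have "integral {c..d} (\<lambda>r. lagr p r (g r) (g' r)) \<ge> 0"
    using sub continuous_on_subset[OF continuous_on_lagr[OF g p] sub]
    by (intro Henstock_Kurzweil_Integration.integral_nonneg integrable_continuous_interval lagr_nonneg) auto
  ultimately show ?thesis
    by (simp add: ennreal_le_iff)
qed

section \<open>The Euler--Lagrange equation\<close>

lemma DERIV_powr_const:
  fixes e :: real
  assumes "(g has_real_derivative m) (at x)" "g x > 0"
  shows "((\<lambda>x. g x powr e) has_real_derivative e * g x powr (e - 1) * m) (at x)"
  using DERIV_fun_powr[OF assms, of e] by simp

lemma continuous_on_powr_nonneg:
  fixes e :: real
  assumes "continuous_on S g" "\<And>x. x \<in> S \<Longrightarrow> 0 \<le> g x" "e > 0"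
  shows "continuous_on S (\<lambda>x. g x powr e)"
  using assms by (intro continuous_on_powr' continuous_on_const) auto

lemma lagr_variation_deriv:
  assumes r: "r > 0" and pos: "y + t * v > 0"
  shows "((\<lambda>t. lagr p r (y + t * v) (y' + t * v')) has_real_derivative
    p * r * ((y' + t * v')\<^sup>2 + (y + t * v)\<^sup>2 / r\<^sup>2) powr (p/2 - 1) * (y' + t * v') * v'
     + (p * ((y' + t * v')\<^sup>2 + (y + t * v)\<^sup>2 / r\<^sup>2) powr (p/2 - 1) * (y + t * v) / r
        - 2 * (y + t * v) * (1 - (y + t * v)\<^sup>2) * r) * v) (at t)"
proof -
  let ?W = "\<lambda>t. (y' + t * v')\<^sup>2 + (y + t * v)\<^sup>2 / r\<^sup>2"
  have W: "?W t > 0"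
    using r pos by (intro add_nonneg_pos) auto
  have "(?W has_real_derivative 2 * (y' + t * v') * v' + 2 * (y + t * v) * v / r\<^sup>2) (at t)"
    using r by (auto intro!: derivative_eq_intros simp: field_simps power2_eq_square)
  then have d1: "((\<lambda>t. ?W t powr (p/2)) has_real_derivative
      p/2 * ?W t powr (p/2 - 1) * (2 * (y' + t * v') * v' + 2 * (y + t * v) * v / r\<^sup>2)) (at t)"
    using W by (rule DERIV_powr_const)
  have d2: "((\<lambda>t. 1/2 * (1 - (y + t * v)\<^sup>2)\<^sup>2) has_real_derivative - 2 * (1 - (y + t * v)\<^sup>2) * (y + t * v) * v) (at t)"
    by (auto intro!: derivative_eq_intros) (simp add: algebra_simps)
  have D: "((\<lambda>t. lagr p r (y + t * v) (y' + t * v')) has_real_derivative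
     (p/2 * ?W t powr (p/2 - 1) * (2 * (y' + t * v') * v' + 2 * (y + t * v) * v / r\<^sup>2)
      + - 2 * (1 - (y + t * v)\<^sup>2) * (y + t * v) * v) * r) (at t)"
    unfolding lagr_def by (intro DERIV_cmult_right DERIV_add d1 d2)
  have eq: "(p/2 * w * (2 * a * v' + 2 * b * v / r\<^sup>2) + - 2 * (1 - b\<^sup>2) * b * v) * r
     = p * r * w * a * v' + (p * w * b / r - 2 * b * (1 - b\<^sup>2) * r) * v" for w a b
    using r by (simp add: field_simps power2_eq_square)
  show ?thesis
    using D unfolding eq .
qed

lemma first_variation:
  assumes p: "p > 2" and f: "nonneg_minimizer p f" "C1_pos f f'"
    and \<phi>: "C1_pos \<phi> \<phi>'" "\<And>x. x \<notin> {c..d} \<Longrightarrow> \<phi> x = 0 \<and> \<phi>' x = 0" "\<And>x. \<bar>\<phi> x\<bar> \<le> 1"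
    and c: "0 < c" "c < d" and pos: "\<And>x. x \<in> {c..d} \<Longrightarrow> f x > 0"
  shows "integral {c..d} (\<lambda>r. p * r * ((f' r)\<^sup>2 + (f r)\<^sup>2 / r\<^sup>2) powr (p/2 - 1) * f' r * \<phi>' r
     + (p * ((f' r)\<^sup>2 + (f r)\<^sup>2 / r\<^sup>2) powr (p/2 - 1) * f r / r - 2 * f r * (1 - (f r)\<^sup>2) * r) * \<phi> r) = 0"
proof -
  have sub: "{c..d} \<subseteq> {0<..}" using c by auto
  note cont = C1_posD(2,3)[OF f(2), THEN continuous_on_subset, OF sub]
    C1_posD(2,3)[OF \<phi>(1), THEN continuous_on_subset, OF sub]
  obtain x0 where x0: "x0 \<in> {c..d}" "\<And>x. x \<in> {c..d} \<Longrightarrow> f x0 \<le> f x"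
    using continuous_attains_inf[of "{c..d}" f] cont(2) c by auto
  define m where "m = f x0"
  have m: "m > 0" "\<And>x. x \<in> {c..d} \<Longrightarrow> m \<le> f x"
    using x0 pos by (auto simp: m_def)
  define U where "U = {-m<..<m}"
  define J where "J t = integral {c..d} (\<lambda>r. lagr p r (f r + t * \<phi> r) (f' r + t * \<phi>' r))" for t
  have pos': "f r + t * \<phi> r > 0" if "r \<in> {c..d}" "t \<in> U" for r t
  proof -
    have "\<bar>t * \<phi> r\<bar> \<le> \<bar>t\<bar> * 1"
      unfolding abs_mult using \<phi>(3) by (intro mult_left_mono) auto
    then show ?thesis
      using m(2)[OF that(1)] that(2) by (auto simp: U_def)
  qed
  have C1: "C1_pos (\<lambda>r. f r + t * \<phi> r) (\<lambda>r. f' r + t * \<phi>' r)" for t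
    unfolding C1_pos_def using C1_posD[OF f(2)] C1_posD[OF \<phi>(1)]
    by (auto intro!: DERIV_add DERIV_cmult continuous_intros)
  let ?D = "\<lambda>t r. p * r * ((f' r + t * \<phi>' r)\<^sup>2 + (f r + t * \<phi> r)\<^sup>2 / r\<^sup>2) powr (p/2 - 1) * (f' r + t * \<phi>' r) * \<phi>' r
     + (p * ((f' r + t * \<phi>' r)\<^sup>2 + (f r + t * \<phi> r)\<^sup>2 / r\<^sup>2) powr (p/2 - 1) * (f r + t * \<phi> r) / r
        - 2 * (f r + t * \<phi> r) * (1 - (f r + t * \<phi> r)\<^sup>2) * r) * \<phi> r"
  have "((\<lambda>t. integral (cbox c d) (\<lambda>r. lagr p r (f r + t * \<phi> r) (f' r + t * \<phi>' r)))
      has_real_derivative integral (cbox c d) (?D 0)) (at 0 within U)"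
  proof (rule leibniz_rule_field_derivative)
    show "((\<lambda>t. lagr p r (f r + t * \<phi> r) (f' r + t * \<phi>' r)) has_real_derivative ?D t r) (at t within U)"
      if "t \<in> U" "r \<in> cbox c d" for t r
      using that c by (intro has_field_derivative_at_within[OF lagr_variation_deriv[OF _ pos']]) simp_all
    show "(\<lambda>r. lagr p r (f r + t * \<phi> r) (f' r + t * \<phi>' r)) integrable_on cbox c d" for t
      using continuous_on_subset[OF continuous_on_lagr[OF C1 p] sub] by (intro integrable_continuous) simp
    have comp: "continuous_on (U \<times> cbox c d) (\<lambda>z. h (snd z))" if "continuous_on {c..d} h" for h :: "real \<Rightarrow> real"
      by (rule continuous_on_compose2[OF that]) (auto intro: continuous_intros)
    show "continuous_on (U \<times> cbox c d) (\<lambda>(t, r). ?D t r)"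
    proof -
      define P where "P z = ((f' (snd z) + fst z * \<phi>' (snd z))\<^sup>2 + (f (snd z) + fst z * \<phi> (snd z))\<^sup>2 / (snd z)\<^sup>2) powr (p/2 - 1)" for z
      note cs = cont[THEN comp]
      have cP: "continuous_on (U \<times> cbox c d) P"
        unfolding P_def using p c
        by (intro continuous_on_powr_nonneg) (auto intro!: continuous_intros cs simp del: box_real)
      have "continuous_on (U \<times> cbox c d) (\<lambda>z. p * snd z * P z * (f' (snd z) + fst z * \<phi>' (snd z)) * \<phi>' (snd z)
        + (p * P z * (f (snd z) + fst z * \<phi> (snd z)) / snd z
        - 2 * (f (snd z) + fst z * \<phi> (snd z)) * (1 - (f (snd z) + fst z * \<phi> (snd z))\<^sup>2) * snd z) * \<phi> (snd z))"
        using c by (auto intro!: continuous_intros cP cs simp del: box_real)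
      then show ?thesis
        unfolding case_prod_unfold P_def .
    qed
    show "0 \<in> U" "convex U"
      using m by (auto simp: U_def)
  qed
  moreover have "at 0 within U = at 0"
    using m by (intro at_within_open) (auto simp: U_def)
  ultimately have dJ: "(J has_real_derivative integral {c..d} (?D 0)) (at 0)"
    unfolding J_def[abs_def] by simp
  have "integral {c..d} (?D 0) = 0"
  proof (rule DERIV_local_min[OF dJ])
    show "m > 0" by fact
    show "\<forall>t. \<bar>0 - t\<bar> < m \<longrightarrow> J 0 \<le> J t"
      unfolding J_def using minimizer_local[OF p f C1 c(1)] \<phi>(2) by simp
  qed
  then show ?thesis by simp
qed

lemma euler_lagrange:
  assumes p: "p > 2" and f: "nonneg_minimizer p f" "smooth_on {0<..} f"
    and r: "r > 0" "f r > 0"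
    and Q: "\<And>x. x > 0 \<Longrightarrow> f x > 0 \<Longrightarrow>
      ((\<lambda>r. p * r * ((deriv f r)\<^sup>2 + (f r)\<^sup>2 / r\<^sup>2) powr (p/2 - 1) * deriv f r) has_real_derivative Q x) (at x)"
      "continuous_on {x. x > 0 \<and> f x > 0} Q"
  shows "Q r = p * ((deriv f r)\<^sup>2 + (f r)\<^sup>2 / r\<^sup>2) powr (p/2 - 1) * f r / r - 2 * f r * (1 - (f r)\<^sup>2) * r"
proof (rule ccontr)
  let ?A = "\<lambda>r. p * r * ((deriv f r)\<^sup>2 + (f r)\<^sup>2 / r\<^sup>2) powr (p/2 - 1) * deriv f r"
  let ?B = "\<lambda>r. p * ((deriv f r)\<^sup>2 + (f r)\<^sup>2 / r\<^sup>2) powr (p/2 - 1) * f r / r - 2 * f r * (1 - (f r)\<^sup>2) * r"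
  assume neq: "Q r \<noteq> ?B r"
  note C1 = C1_pos_smooth[OF f(2)]
  note C1D = C1_posD[OF C1]
  define S where "S = {x. x > 0 \<and> f x > 0}"
  have "open ({0<..} \<inter> f -` {0<..})"
    using C1D(3) by (rule continuous_open_preimage) auto
  also have "{0<..} \<inter> f -` {0<..} = S"
    by (auto simp: S_def)
  finally have S: "open S" .
  have S': "r \<in> S" "S \<subseteq> {0<..}"
    using r by (auto simp: S_def)
  note cS = C1D(2,3)[THEN continuous_on_subset, OF S'(2)]
  define k where "k = ?B r - Q r"
  define E where "E x = - k * (?B x - Q x)" for x
  define P where "P x = ((deriv f x)\<^sup>2 + (f x)\<^sup>2 / x\<^sup>2) powr (p/2 - 1)" for x
  have cP: "continuous_on S P"
    unfolding P_def using p S'(2)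
    by (intro continuous_on_powr_nonneg) (auto intro!: continuous_intros cS)
  have cE: "continuous_on S E"
    unfolding E_def P_def[symmetric] using S'(2) Q(2)[folded S_def]
    by (intro continuous_intros cS cP) auto
  have "k \<noteq> 0"
    using neq by (simp add: k_def)
  then have Er: "E r < 0"
    unfolding E_def k_def[symmetric] by (auto simp add: zero_less_mult_iff)
  have "open (S \<inter> E -` {..<0})" "r \<in> S \<inter> E -` {..<0}"
    using continuous_open_preimage[OF cE S open_lessThan] S'(1) Er by auto
  then obtain e where e: "e > 0" "cball r e \<subseteq> S \<inter> E -` {..<0}"
    using open_contains_cball by blast
  define c d where "c = r - e" and "d = r + e"
  have cd: "{c..d} = cball r e"
    by (auto simp: c_def d_def dist_real_def)
  have cd_S: "{c..d} \<subseteq> S" and cd_E: "\<And>x. x \<in> {c..d} \<Longrightarrow> E x < 0"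
    using e(2) by (auto simp: cd)
  have c: "0 < c" "c < d" "c < r" "r < d"
  proof -
    have "c \<in> {c..d}"
      using e(1) by (simp add: c_def d_def)
    then have "c \<in> {0<..}"
      using cd_S S'(2) by blast
    then show "0 < c" "c < d" "c < r" "r < d"
      using e(1) by (auto simp: c_def d_def)
  qed
  define \<phi> where "\<phi> = bump 1 c d"
  have tf: "test_fun \<phi>"
    unfolding \<phi>_def using c by (intro test_fun_bump) auto
  have sm: "smooth_on UNIV \<phi>"
    using tf by (simp add: test_fun_def)
  have d\<phi>: "(\<phi> has_real_derivative deriv \<phi> x) (at x)" for x
    using smooth_onD(1)[OF sm] by simp
  have c\<phi>: "continuous_on A \<phi>" "continuous_on A (deriv \<phi>)" for A
    using smooth_on_continuous_on[OF sm] smooth_on_continuous_on[OF smooth_onD(2)[OF sm]]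
      continuous_on_subset by blast+
  have outside: "\<phi> x = 0 \<and> deriv \<phi> x = 0" if "x \<notin> {c..d}" for x
  proof -
    have "(\<phi> has_real_derivative 0) (at x)"
      by (rule has_field_derivative_transform_within_open[of "\<lambda>_. 0" _ _ "- {c..d}"])
        (use that in \<open>auto simp: \<phi>_def bump_outside\<close>)
    then show ?thesis
      using that by (auto simp: DERIV_imp_deriv \<phi>_def bump_outside)
  qed
  have var: "integral {c..d} (\<lambda>x. ?A x * deriv \<phi> x + ?B x * \<phi> x) = 0"
  proof (rule first_variation[OF p f(1) C1 _ outside])
    show "C1_pos \<phi> (deriv \<phi>)"
      unfolding C1_pos_def using d\<phi> c\<phi> by auto
    show "\<bar>\<phi> x\<bar> \<le> 1" for x
      using bump_le_1[of 1] bump_nonneg[of 1] by (simp add: \<phi>_def)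
  qed (use c cd_S S_def in auto)
  have parts: "((\<lambda>x. ?A x * deriv \<phi> x + Q x * \<phi> x) has_integral (?A d * \<phi> d - ?A c * \<phi> c)) {c..d}"
  proof (rule fundamental_theorem_of_calculus)
    fix x assume "x \<in> {c..d}"
    then have "((\<lambda>x. ?A x * \<phi> x) has_real_derivative (?A x * deriv \<phi> x + Q x * \<phi> x)) (at x)"
      using DERIV_mult[OF Q(1) d\<phi>, of x] cd_S by (auto simp: S_def algebra_simps)
    then show "((\<lambda>x. ?A x * \<phi> x) has_vector_derivative ?A x * deriv \<phi> x + Q x * \<phi> x) (at x within {c..d})"
      using has_real_derivative_iff_has_vector_derivative has_vector_derivative_at_within by blast
  qed (use c in auto)
  have bnd: "\<phi> c = 0" "\<phi> d = 0"
    by (simp_all add: \<phi>_def bump_outside)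
  have cQ: "continuous_on {c..d} Q"
    using Q(2) cd_S unfolding S_def by (rule continuous_on_subset)
  note ccd = cS[THEN continuous_on_subset, OF cd_S]
  have pos: "x > 0" "f x > 0" if "x \<in> {c..d}" for x
    using that cd_S by (auto simp: S_def)
  have cAB: "continuous_on {c..d} (\<lambda>x. ?A x * deriv \<phi> x + ?B x * \<phi> x)"
    unfolding P_def[symmetric] using c
    by (intro continuous_intros continuous_on_subset[OF cP cd_S] ccd c\<phi>) auto
  have "((\<lambda>x. ?A x * deriv \<phi> x + ?B x * \<phi> x) has_integral 0) {c..d}"
    using integrable_integral[OF integrable_continuous_interval[OF cAB]] var by simp
  from has_integral_diff[OF this parts]
  have "((\<lambda>x. (?B x - Q x) * \<phi> x) has_integral 0) {c..d}"
    by (simp add: bnd left_diff_distrib)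
  from has_integral_mult_right[OF this, of k]
  have "((\<lambda>x. - E x * \<phi> x) has_integral 0) (cbox c d)"
    by (simp add: E_def mult_ac)
  moreover have "continuous_on (cbox c d) (\<lambda>x. - E x * \<phi> x)"
    using continuous_on_subset[OF cE cd_S] by (intro continuous_intros c\<phi>) auto
  moreover have "- E x * \<phi> x \<ge> 0" if "x \<in> cbox c d" for x
    using cd_E[of x] that bump_nonneg[of 1 c d x] by (simp add: \<phi>_def mult_nonpos_nonneg)
  ultimately have "- E r * \<phi> r = 0"
    using c by (intro has_integral_0_cbox_imp_0[where f = "\<lambda>x. - E x * \<phi> x" and x = r]) auto
  then show False
    using bump_pos[of c r d 1] c Er by (simp add: \<phi>_def)
qed

text \<open>The Euler--Lagrange equation in the scale-invariant variables
  \<open>y = r f'\<close>, \<open>z = r\<^sup>2 f''\<close>, \<open>S = f\<^sup>2 + y\<^sup>2\<close>.\<close>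

definition EL :: "real \<Rightarrow> real \<Rightarrow> real \<Rightarrow> real \<Rightarrow> real \<Rightarrow> bool" where
  "EL p r v y z \<longleftrightarrow> z * (v\<^sup>2 + y\<^sup>2 + (p - 2) * y\<^sup>2) =
      (v\<^sup>2 + y\<^sup>2) * v * (1 - 2 / p * (1 - v\<^sup>2) * r powr p * (v\<^sup>2 + y\<^sup>2) powr (1 - p/2))
      - (v\<^sup>2 + y\<^sup>2) * y - (p - 2) * y * (v * y - v\<^sup>2)"

lemma minimizer_EL:
  assumes p: "p > 2" and f: "nonneg_minimizer p f" "smooth_on {0<..} f"
    and r: "r > 0" "f r > 0"
  shows "EL p r (f r) (r * deriv f r) (r\<^sup>2 * deriv (deriv f) r)"
proof -
  let ?f' = "deriv f" and ?f'' = "deriv (deriv f)"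
  let ?W = "\<lambda>r. (?f' r)\<^sup>2 + (f r)\<^sup>2 / r\<^sup>2"
  let ?W' = "\<lambda>r. 2 * ?f' r * ?f'' r + 2 * f r * ?f' r / r\<^sup>2 - 2 * (f r)\<^sup>2 / r ^ 3"
  define Q where "Q r = p * (?W r powr (p/2 - 1) * ?f' r + r * ((p/2 - 1) * ?W r powr (p/2 - 1 - 1) * ?W' r) * ?f' r
      + r * ?W r powr (p/2 - 1) * ?f'' r)" for r
  have sm: "smooth_on {0<..} ?f'" "smooth_on {0<..} ?f''"
    using smooth_onD(2) f(2) by blast+
  have c: "continuous_on {0<..} f" "continuous_on {0<..} ?f'" "continuous_on {0<..} ?f''"
    using f(2) sm smooth_on_continuous_on by blast+
  have W: "?W x > 0" if "x > 0" "f x > 0" for x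
    using that by (intro add_nonneg_pos) auto
  have EL: "Q r = p * ?W r powr (p/2 - 1) * f r / r - 2 * f r * (1 - (f r)\<^sup>2) * r"
  proof (rule euler_lagrange[OF p f r])
    fix x assume x: "x > (0::real)" "f x > 0"
    have d: "(f has_real_derivative ?f' x) (at x)" "(?f' has_real_derivative ?f'' x) (at x)"
      using smooth_onD(1) f(2) sm(1) x(1) by auto
    have "(?W has_real_derivative (2 * ?f' x * ?f'' x + (2 * f x * ?f' x * x\<^sup>2 - (f x)\<^sup>2 * (2 * x)) / (x\<^sup>2 * x\<^sup>2))) (at x)"
      using x by (auto intro!: derivative_eq_intros d)
    also have "2 * ?f' x * ?f'' x + (2 * f x * ?f' x * x\<^sup>2 - (f x)\<^sup>2 * (2 * x)) / (x\<^sup>2 * x\<^sup>2) = ?W' x"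
      using x(1) by (simp add: field_simps power2_eq_square power3_eq_cube)
    finally have dW: "((\<lambda>x. ?W x powr (p/2 - 1)) has_real_derivative (p/2 - 1) * ?W x powr (p/2 - 1 - 1) * ?W' x) (at x)"
      using W[OF x] by (rule DERIV_powr_const)
    have "((\<lambda>x. p * x * ?W x powr (p/2 - 1) * ?f' x) has_real_derivative
       (p * x * ?W x powr (p/2 - 1)) * ?f'' x
        + (p * x * ((p/2 - 1) * ?W x powr (p/2 - 1 - 1) * ?W' x) + p * ?W x powr (p/2 - 1)) * ?f' x) (at x)"
      by (rule derivative_eq_intros dW d refl)+ simp
    then show "((\<lambda>x. p * x * ?W x powr (p/2 - 1) * ?f' x) has_real_derivative Q x) (at x)"
      by (simp add: Q_def algebra_simps)
  next
    let ?S = "{x. x > 0 \<and> f x > 0}"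
    have "?S \<subseteq> {0<..}" by auto
    note cS = c[THEN continuous_on_subset, OF this]
    have cW: "continuous_on ?S ?W"
      by (intro continuous_intros cS) auto
    define P where "P e x = ?W x powr e" for e x
    have cP: "continuous_on ?S (P e)" for e
      unfolding P_def using W by (intro continuous_on_powr cW continuous_on_const) force
    have "continuous_on ?S (\<lambda>r. p * (P (p/2 - 1) r * ?f' r + r * ((p/2 - 1) * P (p/2 - 1 - 1) r * ?W' r) * ?f' r
        + r * P (p/2 - 1) r * ?f'' r))"
      by (intro continuous_intros cP cS) auto
    then show "continuous_on ?S Q"
      unfolding Q_def P_def .
  qed
  define w where "w = ?W r"
  define y where "y = r * ?f' r"
  define z where "z = r\<^sup>2 * ?f'' r"
  define v where "v = f r"
  define S where "S = v\<^sup>2 + y\<^sup>2"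
  have w0: "w > 0" using W[OF r] by (simp add: w_def)
  have wS: "w = S / r\<^sup>2"
    using r(1) by (simp add: w_def S_def y_def v_def add_divide_distrib power_mult_distrib)
  have S0: "S > 0"
    using r by (auto simp: S_def v_def intro: add_pos_nonneg)
  have f': "?f' r = y / r" "?f'' r = z / r\<^sup>2"
    using r(1) by (auto simp: y_def z_def)
  have pw: "w powr (p/2 - 1) = w powr (p/2 - 1 - 1) * w"
    using w0 powr_add[of w "p/2 - 1 - 1" 1] by simp
  define P where "P = w powr (p/2 - 1 - 1)"
  have P0: "P > 0" using w0 by (simp add: P_def)
  have "p * (P * w * (y / r) + r * ((p/2 - 1) * P * (2 * (y / r) * (z / r\<^sup>2) + 2 * v * (y / r) / r\<^sup>2 - 2 * v\<^sup>2 / r ^ 3)) * (y / r)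
      + r * (P * w) * (z / r\<^sup>2)) = p * (P * w) * v / r - 2 * v * (1 - v\<^sup>2) * r"
    using EL[unfolded Q_def, folded w_def, unfolded f', folded v_def, unfolded pw, folded P_def] .
  then have "r ^ 3 / (p * P) * (p * (P * w * (y / r) + r * ((p/2 - 1) * P * (2 * (y / r) * (z / r\<^sup>2) + 2 * v * (y / r) / r\<^sup>2 - 2 * v\<^sup>2 / r ^ 3)) * (y / r)
      + r * (P * w) * (z / r\<^sup>2))) = r ^ 3 / (p * P) * (p * (P * w) * v / r - 2 * v * (1 - v\<^sup>2) * r)"
    by simp
  also have "r ^ 3 / (p * P) * (p * (P * w * (y / r) + r * ((p/2 - 1) * P * (2 * (y / r) * (z / r\<^sup>2) + 2 * v * (y / r) / r\<^sup>2 - 2 * v\<^sup>2 / r ^ 3)) * (y / r)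
      + r * (P * w) * (z / r\<^sup>2))) = S * y + (p - 2) * y * (y * z + v * y - v\<^sup>2) + S * z"
    unfolding wS using r(1) P0 p by (simp add: field_simps power2_eq_square power3_eq_cube)
  also have "r ^ 3 / (p * P) * (p * (P * w) * v / r - 2 * v * (1 - v\<^sup>2) * r)
      = S * v - 2 / p * v * (1 - v\<^sup>2) * (r ^ 4 / P)"
    unfolding wS using r(1) P0 p by (simp add: field_simps power2_eq_square power3_eq_cube power4_eq_xxxx)
  also have "r ^ 4 / P = r powr p * (S * S powr (1 - p/2))"
  proof -
    have "r ^ 4 / P = r powr 4 * w powr (2 - p/2)"
      using r(1) unfolding P_def divide_inverse powr_minus[symmetric] by simp
    also have "w powr (2 - p/2) = S powr (2 - p/2) * (r powr 2) powr - (2 - p/2)"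
    proof -
      have "w powr e = S powr e * (r powr 2) powr - e" for e
        using S0 r(1) by (simp add: wS powr_divide powr_minus_divide)
      then show ?thesis .
    qed
    also have "r powr 4 * (S powr (2 - p/2) * (r powr 2) powr - (2 - p/2)) = S powr (2 - p/2) * (r powr 4 * r powr (2 * - (2 - p/2)))"
      by (simp add: powr_powr mult_ac)
    also have "r powr 4 * r powr (2 * - (2 - p/2)) = r powr p"
      by (simp add: powr_add[symmetric])
    also have "S powr (2 - p/2) = S * S powr (1 - p/2)"
      using S0 powr_add[of S 1 "1 - p/2"] by simp
    finally show ?thesis by (simp add: mult_ac)
  qed
  finally have "S * y + (p - 2) * y * (y * z + v * y - v\<^sup>2) + S * z
      = S * v - 2 / p * v * (1 - v\<^sup>2) * (r powr p * (S * S powr (1 - p/2)))" .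
  then have "z * (S + (p - 2) * y\<^sup>2) = S * v * (1 - 2 / p * (1 - v\<^sup>2) * r powr p * S powr (1 - p/2))
      - S * y - (p - 2) * y * (v * y - v\<^sup>2)"
    by (simp add: algebra_simps power2_eq_square)
  then show ?thesis
    unfolding EL_def S_def v_def[symmetric] y_def[symmetric] z_def[symmetric] .
qed

section \<open>Qualitative behaviour of the minimizer\<close>

lemma integral_Icc_le_nn_integral:
  fixes h :: "real \<Rightarrow> real"
  assumes h: "continuous_on {0<..} h" "\<And>x. x > 0 \<Longrightarrow> h x \<ge> 0"
    and fin: "(\<integral>\<^sup>+x\<in>{0<..}. ennreal (h x) \<partial>lborel) < \<infinity>" and a: "0 < a"
  shows "integral {a..b} h \<le> enn2real (\<integral>\<^sup>+x\<in>{0<..}. ennreal (h x) \<partial>lborel)"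
proof -
  have sub: "{a..b} \<subseteq> {0<..}" using a by auto
  have "ennreal (integral {a..b} h) = (\<integral>\<^sup>+x\<in>{a..b}. ennreal (h x) \<partial>lborel)"
    using h sub by (intro nn_integral_Icc_eq_integral[symmetric] continuous_on_subset[OF h(1)]) auto
  also have "\<dots> \<le> (\<integral>\<^sup>+x\<in>{0<..}. ennreal (h x) \<partial>lborel)"
    using sub by (intro nn_integral_mono) (auto simp: indicator_def)
  finally have le: "ennreal (integral {a..b} h) \<le> (\<integral>\<^sup>+x\<in>{0<..}. ennreal (h x) \<partial>lborel)" .
  have "integral {a..b} h \<ge> 0"
    using h sub by (intro Henstock_Kurzweil_Integration.integral_nonneg integrable_continuous_interval
        continuous_on_subset[OF h(1)]) auto
  then show ?thesis
    using enn2real_mono[OF le] fin by simp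
qed

lemma integral_tail_small:
  fixes h :: "real \<Rightarrow> real"
  assumes h: "continuous_on {0<..} h" "\<And>x. x > 0 \<Longrightarrow> h x \<ge> 0"
    and bd: "\<And>b. integral {1..b} h \<le> E" and e: "e > 0"
  obtains R where "R \<ge> 1" "\<And>a b. R \<le> a \<Longrightarrow> a \<le> b \<Longrightarrow> integral {a..b} h \<le> e"
proof -
  have int: "h integrable_on {a..b}" if "a > 0" for a b
    using that by (intro integrable_continuous_interval continuous_on_subset[OF h(1)]) auto
  define S where "S = (\<lambda>b. integral {1..b} h) ` {1..}"
  have bdd: "bdd_above S"
    using bd by (auto simp: S_def bdd_above_def)
  have "Sup S - e < Sup S" using e by simp
  then obtain s where "s \<in> S" "Sup S - e < s"
    using less_cSup_iff[OF _ bdd, of "Sup S - e"] by (auto simp: S_def)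
  then obtain R where R: "R \<ge> 1" "Sup S - e < integral {1..R} h"
    by (auto simp: S_def)
  show ?thesis
  proof (rule that[OF R(1)])
    fix a b assume ab: "R \<le> a" "a \<le> b"
    have "integral {1..a} h + integral {a..b} h = integral {1..b} h"
      using ab R(1) by (intro Henstock_Kurzweil_Integration.integral_combine int) auto
    moreover have "integral {1..R} h + integral {R..a} h = integral {1..a} h"
      using ab R(1) by (intro Henstock_Kurzweil_Integration.integral_combine int) auto
    moreover have "integral {R..a} h \<ge> 0"
      using h R(1) by (intro Henstock_Kurzweil_Integration.integral_nonneg int) auto
    moreover have "integral {1..b} h \<le> Sup S"
      using ab R(1) by (intro cSup_upper bdd) (auto simp: S_def)
    ultimately show "integral {a..b} h \<le> e"
      using R(2) by linarith
  qed
qed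

lemma finite_energy_tendsto_1:
  assumes p: "p > 2" and f: "C1_pos f f'" "\<And>r. r > 0 \<Longrightarrow> f r \<ge> 0"
    and fin: "(\<integral>\<^sup>+r\<in>{0<..}. ennreal (lagr p r (f r) (f' r)) \<partial>lborel) < \<infinity>"
  shows "(f \<longlongrightarrow> 1) at_top"
proof (rule tendstoI)
  fix \<epsilon> :: real assume "\<epsilon> > 0"
  define e where "e = \<epsilon> / 2"
  have e: "e > 0" using \<open>\<epsilon> > 0\<close> by (simp add: e_def)
  let ?L = "\<lambda>r. lagr p r (f r) (f' r)"
  note cL = continuous_on_lagr[OF f(1) p]
  define l where "l = e / 2"
  have l: "l > 0" using e by (simp add: l_def)
  define d where "d = min (e\<^sup>2 / 4) (l * l powr (p - 1))"
  have d: "d > 0" "d \<le> e\<^sup>2 / 4" "d \<le> l * l powr (p - 1)"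
    using e l by (auto simp: d_def)
  obtain R where R: "R \<ge> 1" "\<And>a b. R \<le> a \<Longrightarrow> a \<le> b \<Longrightarrow> integral {a..b} ?L \<le> d"
    using integral_tail_small[OF cL lagr_nonneg _ d(1)]
      integral_Icc_le_nn_integral[OF cL lagr_nonneg fin, of 1] by auto
  have "\<bar>f r - 1\<bar> < \<epsilon>" if r: "r \<ge> R" for r
  proof -
    have intL: "?L integrable_on {r..s}" for s
      using r R(1) by (intro integrable_continuous_interval continuous_on_subset[OF cL]) auto
    have "\<exists>s\<in>{r..r+1}. \<bar>f s - 1\<bar> < e"
    proof (rule ccontr)
      assume "\<not> ?thesis"
      then have far: "\<bar>f s - 1\<bar> \<ge> e" if "s \<in> {r..r+1}" for s
        using that by (auto simp: not_less)
      have "e\<^sup>2 / 2 \<le> ?L s" if s: "s \<in> {r..r+1}" for s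
      proof -
        have s1: "s \<ge> 1" using s r R(1) by auto
        have "e * 1 \<le> \<bar>f s - 1\<bar> * \<bar>f s + 1\<bar>"
          using far[OF s] f(2)[of s] s1 e by (intro mult_mono) auto
        also have "\<dots> = \<bar>1 - (f s)\<^sup>2\<bar>"
          by (simp add: abs_mult[symmetric] algebra_simps power2_eq_square abs_minus_commute)
        finally have "e\<^sup>2 \<le> (1 - (f s)\<^sup>2)\<^sup>2"
          using e by (metis abs_le_square_iff abs_of_pos mult.right_neutral)
        then have "e\<^sup>2 / 2 * 1 \<le> ((f' s)\<^sup>2 + (f s)\<^sup>2 / s\<^sup>2) powr (p/2) * s + 1/2 * (1 - (f s)\<^sup>2)\<^sup>2 * s"
          using s1 by (intro add_increasing mult_mono) auto
        then show ?thesis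
          by (simp add: lagr_def algebra_simps)
      qed
      then have "integral {r..r+1} (\<lambda>_. e\<^sup>2 / 2) \<le> integral {r..r+1} ?L"
        by (intro integral_le intL) auto
      also have "\<dots> \<le> d" using R(2) r by auto
      finally show False using d(2) zero_less_power[OF e, of 2] by simp
    qed
    then obtain s where s: "s \<in> {r..r+1}" "\<bar>f s - 1\<bar> < e" by blast
    have "(f' has_integral (f s - f r)) {r..s}"
    proof (rule fundamental_theorem_of_calculus)
      show "(f has_vector_derivative f' x) (at x within {r..s})" if "x \<in> {r..s}" for x
        using C1_posD(1)[OF f(1), of x] that r R(1)
        by (auto intro: has_vector_derivative_at_within simp: has_real_derivative_iff_has_vector_derivative)
    qed (use s in auto)
    then have eq: "f s - f r = integral {r..s} f'" and int: "f' integrable_on {r..s}"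
      by (auto simp: integral_unique)
    have "norm (integral {r..s} f') \<le> integral {r..s} (\<lambda>x. l + l powr (1 - p) * ?L x)"
    proof (rule integral_norm_bound_integral[OF int])
      show "(\<lambda>x. l + l powr (1 - p) * ?L x) integrable_on {r..s}"
        by (intro integrable_add integrable_on_mult_right intL) auto
      fix x assume x: "x \<in> {r..s}"
      have x1: "x \<ge> 1" using x r R(1) by auto
      have L0: "?L x \<ge> 0" using x1 by (intro lagr_nonneg) auto
      show "norm (f' x) \<le> l + l powr (1 - p) * ?L x"
      proof (cases "\<bar>f' x\<bar> \<le> l")
        case True
        then show ?thesis using L0 by (simp add: add_increasing2)
      next
        case False
        define t where "t = \<bar>f' x\<bar>"
        have t: "t > l" using False by (simp add: t_def)
        have "t = t powr (1 - p) * t powr p"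
          using t l by (simp add: powr_add[symmetric])
        also have "t powr (1 - p) \<le> l powr (1 - p)"
          using t l p by (intro powr_mono2') auto
        also have "t powr p = ((f' x)\<^sup>2) powr (p/2)"
        proof -
          have "(f' x)\<^sup>2 = t powr 2"
            using t l by (simp add: t_def)
          then show ?thesis by (simp add: powr_powr)
        qed
        also have "((f' x)\<^sup>2) powr (p/2) \<le> ((f' x)\<^sup>2 + (f x)\<^sup>2 / x\<^sup>2) powr (p/2)"
          using p by (intro powr_mono2) auto
        also have "\<dots> \<le> ?L x"
          unfolding lagr_def using x1 by (intro order_trans[OF _ mult_mono[of _ _ 1 x]]) auto
        finally show ?thesis
          using l by (simp add: t_def mult_left_mono mult_right_mono)
      qed
    qed
    also have "\<dots> = (s - r) * l + l powr (1 - p) * integral {r..s} ?L"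
      using s by (subst Henstock_Kurzweil_Integration.integral_add)
        (auto intro!: integrable_on_mult_right intL)
    also have "\<dots> \<le> 1 * l + l powr (1 - p) * (l * l powr (p - 1))"
      using s R(2)[of r s] r l d(3) by (intro add_mono mult_mono mult_left_mono) auto
    also have "l powr (1 - p) * (l * l powr (p - 1)) = l"
      using l by (simp add: powr_add[symmetric] mult.left_commute)
    finally have "\<bar>f s - f r\<bar> \<le> e"
      unfolding eq by (simp add: l_def)
    then show ?thesis using s(2) unfolding e_def by linarith
  qed
  then show "\<forall>\<^sub>F r in at_top. dist (f r) 1 < \<epsilon>"
    unfolding dist_real_def by (intro eventually_at_top_linorderI[of R]) auto
qed

lemma finite_energy_small_near_0:
  assumes p: "p > 2" and f: "C1_pos f f'"
    and fin: "(\<integral>\<^sup>+r\<in>{0<..}. ennreal (lagr p r (f r) (f' r)) \<partial>lborel) < \<infinity>"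
    and c: "0 < c" and r1: "0 < r1"
  shows "\<exists>r. 0 < r \<and> r < r1 \<and> f r < c"
proof (rule ccontr)
  assume "\<not> ?thesis"
  then have ge: "f r \<ge> c" if "0 < r" "r < r1" for r
    using that by (meson not_less)
  let ?L = "\<lambda>r. lagr p r (f r) (f' r)"
  note cL = continuous_on_lagr[OF f p]
  define E where "E = enn2real (\<integral>\<^sup>+r\<in>{0<..}. ennreal (?L r) \<partial>lborel)"
  have E: "integral {a..b} ?L \<le> E" if "a > 0" for a b
    unfolding E_def by (rule integral_Icc_le_nn_integral[OF cL lagr_nonneg fin that]) auto
  have E0: "E \<ge> 0" by (simp add: E_def)
  define m where "m = min 1 (r1 / 2)"
  have m: "m > 0" "m \<le> 1" "m < r1" using r1 by (auto simp: m_def)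
  define t where "t = m * exp (- ((E + 1) / c powr p))"
  have t: "0 < t" "t \<le> m"
    using m c E0 by (auto simp: t_def mult_le_cancel_left1)
  have "((\<lambda>x. c powr p * inverse x) has_integral (c powr p * ln m - c powr p * ln t)) {t..m}"
  proof (rule fundamental_theorem_of_calculus)
    fix x assume "x \<in> {t..m}"
    then have "((\<lambda>x. c powr p * ln x) has_real_derivative c powr p * inverse x) (at x)"
      using t by (auto intro!: derivative_eq_intros simp: inverse_eq_divide)
    then show "((\<lambda>x. c powr p * ln x) has_vector_derivative c powr p * inverse x) (at x within {t..m})"
      using has_real_derivative_iff_has_vector_derivative has_vector_derivative_at_within by blast
  qed (use t in auto)
  moreover have "(?L has_integral (integral {t..m} ?L)) {t..m}"
    using t by (intro integrable_integral integrable_continuous_interval continuous_on_subset[OF cL]) auto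
  moreover have "c powr p * inverse x \<le> ?L x" if x: "x \<in> {t..m}" for x
  proof -
    have x0: "0 < x" "x \<le> 1" "x < r1" using x t m by auto
    have "c powr p * inverse x = c powr p * (x powr -2 * x)"
      using x0 by (simp add: powr_minus power2_eq_square)
    also have "\<dots> \<le> c powr p * (x powr -p * x)"
      using x0 p by (intro mult_left_mono mult_right_mono powr_mono') auto
    also have "\<dots> = (c / x) powr p * x"
      using x0 c by (simp add: powr_divide powr_minus_divide)
    also have "(c / x) powr p = ((c / x)\<^sup>2) powr (p/2)"
      using x0 c by (simp add: powr_powr flip: powr_numeral)
    also have "\<dots> \<le> ((f' x)\<^sup>2 + (f x)\<^sup>2 / x\<^sup>2) powr (p/2)"
      using ge[OF x0(1,3)] x0 c p unfolding power_divide
      by (intro powr_mono2 add_increasing divide_right_mono power_mono) auto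
    also have "\<dots> * x \<le> ?L x"
      unfolding lagr_def using x0 by (intro mult_right_mono) auto
    finally show ?thesis using x0 by simp
  qed
  ultimately have "c powr p * ln m - c powr p * ln t \<le> integral {t..m} ?L"
    by (rule has_integral_le)
  also have "\<dots> \<le> E" by (rule E[OF t(1)])
  also have "ln t = ln m - (E + 1) / c powr p"
    using m by (simp add: t_def ln_mult)
  finally show False
    using c by (simp add: right_diff_distrib)
qed

locale el_profile =
  fixes p :: real and f f1 f2 :: "real \<Rightarrow> real"
  assumes p: "p > 2"
    and d1: "r > 0 \<Longrightarrow> (f has_real_derivative f1 r) (at r)"
    and d2: "r > 0 \<Longrightarrow> (f1 has_real_derivative f2 r) (at r)"
    and EL: "r > 0 \<Longrightarrow> f r > 0 \<Longrightarrow> EL p r (f r) (r * f1 r) (r\<^sup>2 * f2 r)"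
    and lim: "(f \<longlongrightarrow> 1) at_top"
    and small: "c > 0 \<Longrightarrow> r > 0 \<Longrightarrow> \<exists>s. 0 < s \<and> s < r \<and> f s < c"
begin

lemma EL_critical:
  assumes r: "r > 0" "f r > 0" "f1 r = 0"
  shows "r\<^sup>2 * f2 r = f r * (1 - 2 / p * (1 - (f r)\<^sup>2) * r powr p * ((f r)\<^sup>2) powr (1 - p/2))"
proof -
  have "(f r)\<^sup>2 * (r\<^sup>2 * f2 r) = (f r)\<^sup>2 * (f r * (1 - 2 / p * (1 - (f r)\<^sup>2) * r powr p * ((f r)\<^sup>2) powr (1 - p/2)))"
    using EL[OF r(1,2)] r(3) by (simp add: EL_def mult.commute)
  then show ?thesis using r(2) by simp
qed

lemma cont: "continuous_on {a..b} f" "continuous_on {a..b} f1" if "a > 0"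
  using that d1[THEN DERIV_isCont] d2[THEN DERIV_isCont]
  by (auto intro!: continuous_at_imp_continuous_on)

lemma f1_nonneg_aux:
  assumes pos: "\<And>r. r \<ge> R \<Longrightarrow> f r > 0" and r: "r > 0" "r \<ge> R"
  shows "f1 r \<ge> 0"
proof (rule ccontr)
  assume "\<not> f1 r \<ge> 0"
  then have neg: "f1 r < 0" by simp
  have fr: "f r > 0" using pos r by simp
  obtain s where s: "0 < s" "s < r" "f s < f r"
    using small[OF fr r(1)] by blast
  obtain t where t: "s < t" "t < r" "f r - f s = (r - s) * f1 t"
    using MVT2[OF s(2), of f f1] d1 s(1) by auto
  have "f1 t > 0" using t s by (metis diff_gt_0_iff_gt zero_less_mult_pos)
  have t0: "t > 0" using s t by simp
  have comp: "compact {x \<in> {t..r}. f1 x \<ge> 0}"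
    using compact_Int_closed[OF compact_Icc continuous_on_closed_vimage[THEN iffD1, rule_format, OF closed_atLeastAtMost cont(2)[OF t0] closed_atLeast[of 0]], of t r r]
    by (rule back_subst[of compact]) auto
  obtain a where a: "a \<in> {t..r}" "f1 a \<ge> 0" "\<And>x. x \<in> {t..r} \<Longrightarrow> f1 x \<ge> 0 \<Longrightarrow> x \<le> a"
  proof -
    have "t \<in> {x \<in> {t..r}. f1 x \<ge> 0}"
      using \<open>f1 t > 0\<close> t(2) by simp
    then show ?thesis
      using compact_attains_sup[OF comp] that by blast
  qed
  have ar: "0 < a" "a < r"
  proof -
    have "a \<noteq> r" using a(2) neg by auto
    then show "0 < a" "a < r" using a(1) t0 by auto
  qed
  have neg_a: "f1 x < 0" if "a < x" "x \<le> r" for x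
    using a(3)[of x] a(1) that by force
  have f1a: "f1 a = 0"
  proof (rule ccontr)
    assume "f1 a \<noteq> 0"
    then have "f1 a > 0" using a(2) by simp
    then obtain x where "a \<le> x" "x \<le> r" "f1 x = 0"
      using IVT2'[of f1 r 0 a] neg ar cont(2)[OF ar(1), of r] by auto
    then show False
      using neg_a[of x] \<open>f1 a > 0\<close> by (cases "x = a") auto
  qed
  have f2a: "f2 a \<le> 0"
  proof (rule ccontr)
    assume "\<not> f2 a \<le> 0"
    then obtain e where e: "e > 0" "\<And>h. 0 < h \<Longrightarrow> h < e \<Longrightarrow> f1 a < f1 (a + h)"
      using DERIV_pos_inc_right[OF d2[OF ar(1)]] by force
    define h where "h = min (e / 2) (r - a)"
    have "0 < h" "h < e" "a + h \<le> r" using e(1) ar by (auto simp: h_def)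
    then show False
      using e(2)[of h] neg_a[of "a + h"] f1a by auto
  qed
  have dec: "f y < f a" if y: "a < y" "\<And>x. a < x \<Longrightarrow> x < y \<Longrightarrow> f1 x < 0" for y
  proof -
    obtain x where "a < x" "x < y" "f y - f a = (y - a) * f1 x"
      using MVT2[OF y(1), of f f1] d1 ar(1) by auto
    then show ?thesis
      using y by (metis diff_gt_0_iff_gt diff_less_0_iff_less mult_pos_neg)
  qed
  have fa: "f a > 0"
    using dec[of r] ar neg_a fr by force
  let ?K = "\<lambda>x. 2 / p * (1 - (f x)\<^sup>2) * x powr p * ((f x)\<^sup>2) powr (1 - p/2)"
  have "f a * (1 - ?K a) \<le> 0"
    using EL_critical[OF ar(1) fa f1a] f2a by (metis mult_nonneg_nonpos zero_le_power2)
  then have Ka: "?K a \<ge> 1"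
    using fa by (simp add: mult_le_0_iff)
  have ua: "1 - (f a)\<^sup>2 > 0"
  proof (rule ccontr)
    assume "\<not> 1 - (f a)\<^sup>2 > 0"
    then have "?K a \<le> 0"
      using p by (intro mult_nonpos_nonneg mult_nonneg_nonpos) auto
    then show False using Ka by simp
  qed
  have neg_all: "f1 x < 0" if x: "a < x" for x
  proof (rule ccontr)
    assume "\<not> f1 x < 0"
    then have x': "f1 x \<ge> 0" "x > r" using neg_a[of x] x by force+
    have comp: "compact {y \<in> {r..x}. f1 y \<ge> 0}"
      using compact_Int_closed[OF compact_Icc continuous_on_closed_vimage[THEN iffD1, rule_format, OF closed_atLeastAtMost cont(2)[OF r(1)] closed_atLeast[of 0]], of r x x]
      by (rule back_subst[of compact]) auto
    obtain b where b: "b \<in> {r..x}" "f1 b \<ge> 0" "\<And>y. y \<in> {r..x} \<Longrightarrow> f1 y \<ge> 0 \<Longrightarrow> b \<le> y"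
    proof -
      have "x \<in> {y \<in> {r..x}. f1 y \<ge> 0}"
        using x' by simp
      then show ?thesis
        using compact_attains_inf[OF comp] that by blast
    qed
    have "b \<noteq> r" using b(2) neg by auto
    then have rb: "r < b" using b(1) by simp
    have neg_b: "f1 y < 0" if "a < y" "y < b" for y
      using neg_a[of y] b(1) b(3)[of y] that by (cases "y \<le> r"; cases "f1 y < 0") (auto simp: not_less)
    have f1b: "f1 b = 0"
    proof (rule ccontr)
      assume "f1 b \<noteq> 0"
      then have "f1 b > 0" using b(2) by simp
      then obtain y where "r \<le> y" "y \<le> b" "f1 y = 0"
        using IVT'[of f1 r 0 b] neg rb cont(2)[OF r(1), of b] by auto
      then show False
        using neg_b[of y] \<open>f1 b > 0\<close> ar by (cases "y = b") auto
    qed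
    have b0: "b > 0" "f b > 0" using r rb pos by auto
    have fba: "f b < f a"
      using dec[of b] ar rb neg_b by auto
    have sq: "(f b)\<^sup>2 < (f a)\<^sup>2"
      using fba b0 by (intro power_strict_mono) auto
    have "?K a < ?K b"
    proof -
      have "2 / p * (1 - (f a)\<^sup>2) * a powr p < 2 / p * (1 - (f b)\<^sup>2) * b powr p"
        using p sq ua ar rb by (intro mult_strict_mono mult_strict_left_mono powr_less_mono2) auto
      moreover have "((f a)\<^sup>2) powr (1 - p/2) \<le> ((f b)\<^sup>2) powr (1 - p/2)"
        using sq b0 p by (intro powr_mono2') auto
      moreover have "((f a)\<^sup>2) powr (1 - p/2) > 0" "2 / p * (1 - (f a)\<^sup>2) * a powr p > 0"
        using fa ua p ar by auto
      ultimately show ?thesis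
        by (intro mult_less_le_imp_less[where b = "2 / p * (1 - (f b)\<^sup>2) * b powr p"]) (auto intro: less_imp_le)
    qed
    then have "f b * (1 - ?K b) < 0"
      using Ka b0 by (intro mult_pos_neg) auto
    then have "b\<^sup>2 * f2 b < 0"
      using EL_critical[OF b0 f1b] by simp
    then have "f2 b < 0"
      by (simp add: mult_less_0_iff)
    then obtain e where e: "e > 0" "\<And>h. 0 < h \<Longrightarrow> h < e \<Longrightarrow> f1 b < f1 (b - h)"
      using DERIV_neg_dec_left[OF d2[OF b0(1)]] by force
    define h where "h = min (e / 2) ((b - a) / 2)"
    have "0 < h" "h < e" "a < b - h"
      using e(1) ar rb by (auto simp: h_def min_def field_simps)
    then show False
      using e(2)[of h] neg_b[of "b - h"] f1b by auto
  qed
  have "f y \<le> f a" if "y > a" for y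
    using dec[of y] neg_all that by force
  then have "\<forall>\<^sub>F y in at_top. f y \<le> f a"
    by (intro eventually_at_top_linorderI[of "a + 1"]) auto
  then have "1 \<le> f a"
    using tendsto_upperbound[OF lim] by simp
  then have "1 \<le> (f a)\<^sup>2"
    by simp
  then show False using ua by simp
qed

lemma eventually_f1_nonneg: "\<forall>\<^sub>F r in at_top. f1 r \<ge> 0"
proof -
  obtain R where R: "\<And>r. r \<ge> R \<Longrightarrow> f r > 0"
    using order_tendstoD(1)[OF lim, of 0] by (auto simp: eventually_at_top_linorder)
  show ?thesis
    using eventually_gt_at_top[of 0] eventually_ge_at_top[of R]
    by eventually_elim (use f1_nonneg_aux[OF R] in auto)
qed

lemma eventually_f_le_1: "\<forall>\<^sub>F r in at_top. f r \<le> 1"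
proof -
  obtain R where R: "R > 0" "\<And>r. r \<ge> R \<Longrightarrow> f1 r \<ge> 0"
    using eventually_conj[OF eventually_f1_nonneg eventually_gt_at_top[of 0]]
    unfolding eventually_at_top_linorder by (metis le_cases order_trans)
  have "f r \<le> 1" if r: "r \<ge> R" for r
  proof -
    have "f r \<le> f s" if "r \<le> s" for s
      using that r R d1 by (intro DERIV_nonneg_imp_nondecreasing[OF that]) (meson less_le_trans order_trans)
    then have "\<forall>\<^sub>F s in at_top. f r \<le> f s"
      by (intro eventually_at_top_linorderI[of r])
    then show ?thesis
      using tendsto_lowerbound[OF lim] by simp
  qed
  then show ?thesis
    by (intro eventually_at_top_linorderI[of R])
qed

end

lemma minimizer_el_profile:
  assumes p: "p > 2" and f: "nonneg_minimizer p f" "smooth_on {0<..} f"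
  shows "el_profile p f (deriv f) (deriv (deriv f))"
proof -
  note C1 = C1_pos_smooth[OF f(2)]
  note fin = minimizer_finite_energy[OF p f(1) C1]
  have nonneg: "\<And>r. r > 0 \<Longrightarrow> f r \<ge> 0"
    using f(1) by (simp add: nonneg_minimizer_def)
  show ?thesis
    by unfold_locales
      (use p smooth_onD[OF f(2)] smooth_onD(1)[OF smooth_onD(2)[OF f(2)]] minimizer_EL[OF p f]
        finite_energy_tendsto_1[OF p C1 nonneg fin] finite_energy_small_near_0[OF p C1 fin] in auto)
qed

section \<open>Barriers\<close>

lemma interior_max:
  fixes h :: "real \<Rightarrow> real"
  assumes R: "R > 0" "h R \<le> 0" "(h \<longlongrightarrow> 0) at_top"
    and d1: "\<And>r. r > 0 \<Longrightarrow> (h has_real_derivative h1 r) (at r)"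
    and d2: "\<And>r. r > 0 \<Longrightarrow> (h1 has_real_derivative h2 r) (at r)"
    and s: "s \<ge> R" "h s > 0"
  obtains m where "m > R" "h m > 0" "h1 m = 0" "h2 m \<le> 0"
proof -
  obtain T where T: "\<And>t. t \<ge> T \<Longrightarrow> h t < h s"
    using order_tendstoD(2)[OF R(3) s(2)] by (auto simp: eventually_at_top_linorder)
  have sT: "s < T" using T[of s] by (cases "s < T") auto
  have "continuous_on {R..T} h"
    using R(1) DERIV_isCont[OF d1] by (auto intro!: continuous_at_imp_continuous_on)
  then obtain m where m: "m \<in> {R..T}" "\<And>x. x \<in> {R..T} \<Longrightarrow> h x \<le> h m"
    using continuous_attains_sup[of "{R..T}" h] sT s(1) by auto
  have hm: "h m > 0" "h s \<le> h m"
    using m(2)[of s] s sT by auto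
  have "m \<noteq> R" "m \<noteq> T" using hm R(2) T[of T] by auto
  then have mR: "R < m" "m < T" using m(1) by auto
  then have m0: "m > 0" using R(1) by simp
  have h1: "h1 m = 0"
  proof (rule DERIV_local_max[OF d1[OF m0]])
    show "0 < min (m - R) (T - m)" using mR by simp
    show "\<forall>y. \<bar>m - y\<bar> < min (m - R) (T - m) \<longrightarrow> h y \<le> h m"
      by (intro allI impI m(2)) auto
  qed
  have "h2 m \<le> 0"
  proof (rule ccontr)
    assume "\<not> h2 m \<le> 0"
    then obtain e where e: "e > 0" "\<And>k. 0 < k \<Longrightarrow> k < e \<Longrightarrow> h1 m < h1 (m + k)"
      using DERIV_pos_inc_right[OF d2[OF m0]] by force
    define k where "k = min (e / 2) (T - m)"
    have k: "0 < k" "k < e" "m + k \<le> T" using e(1) mR by (auto simp: k_def)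
    obtain x where x: "m < x" "x < m + k" "h (m + k) - h m = (m + k - m) * h1 x"
      using MVT2[of m "m + k" h h1] d1 k(1) m0 by auto
    have "h1 x > 0" using e(2)[of "x - m"] x k h1 by auto
    then have "h (m + k) > h m" using x(3) k(1) by (simp add: algebra_simps)
    then show False using m(2)[of "m + k"] k mR by auto
  qed
  then show ?thesis using that mR hm h1 by blast
qed

lemma DERIV_powr_minus:
  fixes p r :: real
  assumes "r > 0"
  shows "((\<lambda>r. r powr - p) has_real_derivative - p * r powr - p / r) (at r)"
  using DERIV_powr_const[of "\<lambda>r. r" 1 r "- p"] assms
  by (simp add: powr_diff)

lemma barrier_derivs:
  fixes p a b r :: real
  assumes r: "r > 0"
  shows "((\<lambda>r. 1 - a * r powr - p + b * (r powr - p)\<^sup>2) has_real_derivative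
      (p * a * r powr - p - 2 * p * b * (r powr - p)\<^sup>2) / r) (at r)"
    and "((\<lambda>r. (p * a * r powr - p - 2 * p * b * (r powr - p)\<^sup>2) / r) has_real_derivative
      (- (p * (p + 1) * a * r powr - p) + 2 * p * (2 * p + 1) * b * (r powr - p)\<^sup>2) / r\<^sup>2) (at r)"
proof -
  define g where "g r = r powr - p" for r
  have g: "(g has_real_derivative - p * g r / r) (at r)"
    unfolding g_def using DERIV_powr_minus[OF r] .
  have "((\<lambda>r. 1 - a * g r + b * (g r)\<^sup>2) has_real_derivative
      (p * a * g r - 2 * p * b * (g r)\<^sup>2) / r) (at r)"
    using r by (auto intro!: derivative_eq_intros g simp: field_simps power2_eq_square)
  then show "((\<lambda>r. 1 - a * r powr - p + b * (r powr - p)\<^sup>2) has_real_derivative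
      (p * a * r powr - p - 2 * p * b * (r powr - p)\<^sup>2) / r) (at r)"
    by (simp add: g_def)
  have "((\<lambda>r. (p * a * g r - 2 * p * b * (g r)\<^sup>2) / r) has_real_derivative
      (- (p * (p + 1) * a * g r) + 2 * p * (2 * p + 1) * b * (g r)\<^sup>2) / r\<^sup>2) (at r)"
    using r by (auto intro!: derivative_eq_intros g simp: field_simps power2_eq_square)
  then show "((\<lambda>r. (p * a * r powr - p - 2 * p * b * (r powr - p)\<^sup>2) / r) has_real_derivative
      (- (p * (p + 1) * a * r powr - p) + 2 * p * (2 * p + 1) * b * (r powr - p)\<^sup>2) / r\<^sup>2) (at r)"
    by (simp add: g_def)
qed

lemma tendsto_powr_minus_at_top:
  fixes p :: real
  assumes "p > 0"
  shows "((\<lambda>r. r powr - p) \<longlongrightarrow> 0) at_top"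
  using assms by (intro tendsto_neg_powr filterlim_ident) auto

lemma barrier_tendsto:
  fixes p a b :: real
  assumes "p > 0"
  shows "((\<lambda>r. 1 - a * r powr - p + b * (r powr - p)\<^sup>2) \<longlongrightarrow> 1) at_top"
proof -
  have "((\<lambda>r. 1 - a * r powr - p + b * (r powr - p)\<^sup>2) \<longlongrightarrow> 1 - a * 0 + b * 0\<^sup>2) at_top"
    by (intro tendsto_intros tendsto_powr_minus_at_top assms)
  then show ?thesis by simp
qed

lemma EL_upper_bound:
  fixes p :: real
  assumes p: "p > 2"
  defines "A \<equiv> p^4 + 2 * p^3 + 2 * p^2"
  assumes X: "X = r powr p" "x = 1 / X" "r > 0" "p\<^sup>2 * x \<le> 1"
    and M: "M \<ge> 0" "M * x \<le> p / 4"
    and v: "1 / 2 \<le> v" "v \<le> 1" "1 - v \<le> p / 4 * x - M * x\<^sup>2"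
    and y: "\<bar>y\<bar> \<le> p\<^sup>2 * x" and z: "z \<le> p^3 * x" and EL: "EL p r v y z"
  shows "M \<le> p / 4 * (8 * A + p\<^sup>2)"
proof -
  have x0: "x > 0" "X > 0" "X * x = 1" using X by auto
  define S where "S = v\<^sup>2 + y\<^sup>2"
  define K where "K = 2 / p * (1 - v\<^sup>2) * X * S powr (1 - p/2)"
  have y1: "\<bar>y\<bar> \<le> 1" using y X(4) by linarith
  then have y2: "y\<^sup>2 \<le> 1" by (simp add: abs_square_le_1)
  have v2: "1 / 4 \<le> v\<^sup>2" "v\<^sup>2 \<le> 1"
    using power_mono[OF v(1), of 2] v by (auto simp: power_one_over power_le_one)
  have S: "1 / 4 \<le> S" "S \<le> 2" "v\<^sup>2 \<le> S"
    using v2 y2 zero_le_power2[of y] unfolding S_def by linarith+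
  have eq: "z * (S + (p - 2) * y\<^sup>2) = S * v * (1 - K) - S * y - (p - 2) * y * (v * y - v\<^sup>2)"
    using EL unfolding EL_def S_def K_def X(1) .
  have nn: "0 \<le> (p - 2) * y\<^sup>2" "(p - 2) * y\<^sup>2 \<le> (p - 2) * 1"
    using p y2 by (auto intro: mult_left_mono)
  have Sp: "S + (p - 2) * y\<^sup>2 \<le> p"
    using add_mono[OF S(2) nn(2)] by simp
  have "z * (S + (p - 2) * y\<^sup>2) \<le> p^3 * x * (S + (p - 2) * y\<^sup>2)"
    using z nn S by (intro mult_right_mono) auto
  also have "\<dots> \<le> p^3 * x * p"
    using Sp p x0 by (intro mult_left_mono) auto
  finally have b1: "z * (S + (p - 2) * y\<^sup>2) \<le> p^4 * x"
    by (simp add: power4_eq_xxxx power3_eq_cube mult_ac)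
  have "\<bar>S * y\<bar> \<le> 2 * (p\<^sup>2 * x)"
    unfolding abs_mult using S y by (intro mult_mono) auto
  then have b2: "S * y \<le> 2 * (p\<^sup>2 * x)" by linarith
  have "\<bar>v * y\<bar> \<le> 1 * 1" unfolding abs_mult using v y1 by (intro mult_mono) auto
  then have "\<bar>v * y - v\<^sup>2\<bar> \<le> 2" using v2 by linarith
  then have "\<bar>(p - 2) * y * (v * y - v\<^sup>2)\<bar> \<le> p * (p\<^sup>2 * x) * 2"
    unfolding abs_mult using p y x0 by (intro mult_mono) auto
  then have b3: "(p - 2) * y * (v * y - v\<^sup>2) \<le> 2 * p^3 * x"
    by (simp add: power3_eq_cube power2_eq_square mult_ac)
  have SvK: "S * v * (1 - K) \<le> A * x"
    using eq b1 b2 b3 by (simp add: A_def algebra_simps)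
  have A0: "A \<ge> 0" using p by (simp add: A_def)
  have "1 - K \<le> 8 * A * x"
  proof (cases "1 - K \<le> 0")
    case True
    then show ?thesis using A0 x0 by (meson mult_nonneg_nonneg less_imp_le order_trans zero_le_numeral)
  next
    case False
    have "1 / 4 * (1 / 2) * (1 - K) \<le> S * v * (1 - K)"
      using False S v by (intro mult_right_mono mult_mono) auto
    then show ?thesis using SvK by simp
  qed
  moreover have "K \<le> 1 - 4 / p * M * x + p\<^sup>2 * x"
  proof -
    have "- ln v \<le> p / 2 * x"
    proof -
      have "ln (1 / v) \<le> 1 / v - 1"
        using v by (intro ln_le_minus_one) auto
      also have "\<dots> = (1 - v) / v"
        using v by (simp add: field_simps)
      also have "\<dots> \<le> (p / 4 * x) / (1 / 2)"
      proof -
        have "M * x\<^sup>2 \<ge> 0" using M by simp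
        then have "1 - v \<le> p / 4 * x" using v by linarith
        then show ?thesis using v x0 p by (intro frac_le) auto
      qed
      finally show ?thesis using v by (simp add: ln_div)
    qed
    then have "(p - 2) * (- ln v) \<le> (p - 2) * (p / 2 * x)"
      using p by (intro mult_left_mono) auto
    also have "\<dots> \<le> p\<^sup>2 * x / 2"
      using p x0 by (simp add: power2_eq_square field_simps)
    finally have l: "(2 - p) * ln v \<le> p\<^sup>2 * x / 2"
      by (simp add: algebra_simps)
    have "S powr (1 - p/2) \<le> (v\<^sup>2) powr (1 - p/2)"
      using S v p by (intro powr_mono2') auto
    also have "\<dots> = (v powr 2) powr (1 - p/2)"
      using v by simp
    also have "\<dots> = exp ((2 - p) * ln v)"
      using v unfolding powr_powr by (simp add: powr_def algebra_simps)
    also have "\<dots> \<le> exp (p\<^sup>2 * x / 2)"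
      using l by simp
    also have "\<dots> \<le> 1 + p\<^sup>2 * x / 2 + (p\<^sup>2 * x / 2)\<^sup>2"
      using X(4) x0 by (intro exp_bound) auto
    also have "(p\<^sup>2 * x / 2)\<^sup>2 \<le> p\<^sup>2 * x / 2"
      using X(4) x0 p by (simp add: power2_eq_square mult_left_le)
    finally have P: "S powr (1 - p/2) \<le> 1 + p\<^sup>2 * x" by (simp add: mult.commute)
    have "1 - v\<^sup>2 = (1 - v) * (1 + v)" by (simp add: algebra_simps power2_eq_square)
    also have "\<dots> \<le> (p / 4 * x - M * x\<^sup>2) * 2"
      using v by (intro mult_mono) auto
    finally have "2 / p * (1 - v\<^sup>2) * X \<le> 2 / p * ((p / 4 * x - M * x\<^sup>2) * 2) * X"
      using p x0 by (intro mult_right_mono mult_left_mono) auto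
    also have "\<dots> = (1 - 4 / p * M * x) * (X * x)"
      using p by (simp add: field_simps power2_eq_square)
    finally have Q: "2 / p * (1 - v\<^sup>2) * X \<le> 1 - 4 / p * M * x"
      using x0 by simp
    have q: "0 \<le> 1 - 4 / p * M * x" "0 \<le> 4 / p * M * x"
      using M p x0 by (auto simp: field_simps)
    have "K \<le> (1 - 4 / p * M * x) * (1 + p\<^sup>2 * x)"
      unfolding K_def using P Q q by (intro mult_mono) auto
    also have "\<dots> \<le> 1 - 4 / p * M * x + 1 * (p\<^sup>2 * x)"
      unfolding distrib_left mult_1_right using q x0 by (intro add_left_mono mult_right_mono) auto
    finally show ?thesis by simp
  qed
  ultimately have "4 / p * M * x \<le> (8 * A + p\<^sup>2) * x"
    by (simp add: algebra_simps)
  then have "4 / p * M \<le> 8 * A + p\<^sup>2"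
    using x0(1) by (rule mult_right_le_imp_le)
  then show ?thesis using p by (simp add: field_simps)
qed

lemma EL_lower_bound:
  fixes p :: real
  assumes p: "p > 2"
  defines "C \<equiv> 8 * (2 * p * (2 * p + 1) * p + 2 * p^2) + (2 * p^2 + 1)"
  assumes X: "X = r powr p" "x = 1 / X" "r > 0" "p * C * x \<le> 1"
    and M: "M \<ge> 0" and w: "w = p / 4 * x + M * x\<^sup>2" "2 * C * w \<le> 1"
    and v: "1 / 2 \<le> v" "v \<le> 1" "1 - v \<ge> w"
    and y: "0 \<le> y" "y \<le> 2 * p * w" and z: "z \<ge> - (2 * p * (2 * p + 1) * w)" and EL: "EL p r v y z"
  shows "M \<le> p\<^sup>2 / 4 * C"
proof -
  have x0: "x > 0" "X > 0" "X * x = 1" using X by auto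
  have w0: "w \<ge> 0" using w M p x0 by auto
  have p2: "p\<^sup>2 \<ge> 2 * p" "p\<^sup>2 \<ge> 0"
    using p by (auto simp: power2_eq_square)
  define A B where "A = 8 * (2 * p * (2 * p + 1) * p + 2 * p^2)" and "B = 2 * p\<^sup>2 + 1"
  have AB: "C = A + B" "0 \<le> A" "1 \<le> B" "2 * p \<le> B"
    using p p2 by (auto simp: C_def A_def B_def)
  have Bw: "2 * (B * w) \<le> 1"
  proof -
    have "2 * (A * w) \<ge> 0" using AB w0 by simp
    then show ?thesis using w(2) unfolding AB(1) by (simp add: algebra_simps)
  qed
  have pw: "2 * p * w \<le> B * w" using AB w0 by (intro mult_right_mono) auto
  then have y1: "y \<le> 1" using y Bw w0 by linarith
  have w1: "w \<le> B * w" using AB w0 by (simp add: mult_le_cancel_right1)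
  define S where "S = v\<^sup>2 + y\<^sup>2"
  define K where "K = 2 / p * (1 - v\<^sup>2) * X * S powr (1 - p/2)"
  have y2: "y\<^sup>2 \<le> y" "y\<^sup>2 \<le> 1"
    using y y1 by (auto simp: power2_eq_square mult_left_le intro: order_trans[OF mult_left_le])
  have v2: "1 / 4 \<le> v\<^sup>2" "v\<^sup>2 \<le> 1"
    using power_mono[OF v(1), of 2] v by (auto simp: power_one_over power_le_one)
  have S: "1 / 4 \<le> S" "S \<le> 2" "S \<le> 1 + y\<^sup>2"
    using v2 y2 zero_le_power2[of y] unfolding S_def by linarith+
  have eq: "z * (S + (p - 2) * y\<^sup>2) = S * v * (1 - K) - S * y - (p - 2) * y * (v * y - v\<^sup>2)"
    using EL unfolding EL_def S_def K_def X(1) .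
  have nn: "0 \<le> (p - 2) * y\<^sup>2" "(p - 2) * y\<^sup>2 \<le> (p - 2) * 1"
    using p y2 by (auto intro: mult_left_mono)
  have Sp: "S + (p - 2) * y\<^sup>2 \<le> p"
    using add_mono[OF S(2) nn(2)] by simp
  have "2 * p * (2 * p + 1) * w * (S + (p - 2) * y\<^sup>2) \<le> 2 * p * (2 * p + 1) * w * p"
    using Sp p w0 by (intro mult_left_mono) auto
  moreover have "z * (S + (p - 2) * y\<^sup>2) \<ge> - (2 * p * (2 * p + 1) * w) * (S + (p - 2) * y\<^sup>2)"
    using z nn S by (intro mult_right_mono) auto
  ultimately have b1: "z * (S + (p - 2) * y\<^sup>2) \<ge> - (2 * p * (2 * p + 1) * p * w)"
    by (simp add: mult_ac)
  have b2: "S * y \<ge> 0" using S y by auto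
  have "(p - 2) * y * (v\<^sup>2 - v * y) \<le> p * (2 * p * w) * 1"
  proof -
    have "(p - 2) * y * (v\<^sup>2 - v * y) \<le> (p - 2) * y * 1"
      using p y v v2 by (intro mult_left_mono) (auto intro: order_trans[of _ "v\<^sup>2"])
    also have "\<dots> \<le> p * (2 * p * w) * 1"
      using p y w0 by (intro mult_right_mono mult_mono) auto
    finally show ?thesis .
  qed
  then have b3: "(p - 2) * y * (v * y - v\<^sup>2) \<ge> - (2 * p\<^sup>2 * w)"
    by (simp add: algebra_simps power2_eq_square)
  have SvK: "S * v * (K - 1) \<le> A / 8 * w"
    using eq b1 b2 b3 by (simp add: A_def algebra_simps)
  have "K - 1 \<le> A * w"
  proof (cases "K - 1 \<le> 0")
    case True
    then show ?thesis using AB w0 by (meson mult_nonneg_nonneg order_trans)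
  next
    case False
    have "1 / 4 * (1 / 2) * (K - 1) \<le> S * v * (K - 1)"
      using False S v by (intro mult_right_mono mult_mono) auto
    then show ?thesis using SvK by simp
  qed
  moreover have "K \<ge> (1 + 4 / p * M * x) * (1 - B * w)"
  proof -
    have "1 - 2 * p\<^sup>2 * w \<le> 1 + (1 - p/2) * y\<^sup>2"
    proof -
      have "(p/2 - 1) * y\<^sup>2 \<le> p * (2 * p * w)"
        using p y y2 by (intro mult_mono) auto
      then show ?thesis by (simp add: algebra_simps power2_eq_square)
    qed
    also have "\<dots> \<le> 1 + (1 - p/2) * ln (1 + y\<^sup>2)"
      using ln_add_one_self_le_self[of "y\<^sup>2"] p by (intro add_left_mono mult_left_mono_neg) auto
    also have "\<dots> \<le> exp ((1 - p/2) * ln (1 + y\<^sup>2))"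
      by (rule exp_ge_add_one_self)
    also have "\<dots> = (1 + y\<^sup>2) powr (1 - p/2)"
      by (simp add: powr_def add_nonneg_eq_0_iff)
    also have "\<dots> \<le> S powr (1 - p/2)"
      using S p by (intro powr_mono2') auto
    finally have P: "1 - 2 * p\<^sup>2 * w \<le> S powr (1 - p/2)" .
    have vw: "w * (2 - w) \<le> (1 - v) * (2 - (1 - v))"
    proof -
      have "(1 - v) * (2 - (1 - v)) - w * (2 - w) = ((1 - v) - w) * (2 - (1 - v) - w)"
        by (simp add: algebra_simps)
      moreover have "0 \<le> \<dots>"
        using v w1 Bw by (intro mult_nonneg_nonneg) auto
      ultimately show ?thesis by linarith
    qed
    have "2 / p * (w * (2 - w)) * X \<le> 2 / p * ((1 - v) * (2 - (1 - v))) * X"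
      using p x0 vw by (intro mult_right_mono mult_left_mono) auto
    also have "(1 - v) * (2 - (1 - v)) = 1 - v\<^sup>2"
      by (simp add: algebra_simps power2_eq_square)
    also have "2 / p * (w * (2 - w)) * X = (4 / p * (w * X)) * (1 - w / 2)"
      using p by (simp add: field_simps)
    also have "w * X = (p / 4 + M * x) * (X * x)"
      unfolding w(1) by (simp add: algebra_simps power2_eq_square)
    also have "4 / p * ((p / 4 + M * x) * (X * x)) = 1 + 4 / p * M * x"
      unfolding x0(3) using p by (simp add: field_simps)
    finally have Q: "(1 + 4 / p * M * x) * (1 - w / 2) \<le> 2 / p * (1 - v\<^sup>2) * X" .
    have q: "0 \<le> 4 / p * M * x" using M p x0 by auto
    have bw: "2 * p\<^sup>2 * w + w = B * w" by (simp add: B_def algebra_simps)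
    have pw0: "0 \<le> 2 * p\<^sup>2 * w" using w0 by simp
    have "1 - B * w \<le> (1 - w / 2) * (1 - 2 * p\<^sup>2 * w)"
    proof -
      have "(1 - w / 2) * (1 - 2 * p\<^sup>2 * w) = 1 - w / 2 - 2 * p\<^sup>2 * w + w * (2 * p\<^sup>2 * w) / 2"
        by (simp add: algebra_simps)
      then show ?thesis
        using mult_nonneg_nonneg[OF w0 pw0] w0 bw by linarith
    qed
    then have "(1 + 4 / p * M * x) * (1 - B * w) \<le> (1 + 4 / p * M * x) * ((1 - w / 2) * (1 - 2 * p\<^sup>2 * w))"
      using q by (intro mult_left_mono) auto
    also have "\<dots> = (1 + 4 / p * M * x) * (1 - w / 2) * (1 - 2 * p\<^sup>2 * w)"
      by simp
    also have "\<dots> \<le> 2 / p * (1 - v\<^sup>2) * X * S powr (1 - p/2)"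
      using Bw bw pw0 w0 v2 p x0 by (intro mult_mono[OF Q P]) auto
    finally show ?thesis by (simp add: K_def)
  qed
  ultimately have "(1 + 4 / p * M * x) * (1 - B * w) \<le> 1 + A * w"
    by linarith
  moreover have "\<mu> \<le> A * w + B * w + \<mu> * (B * w)" if "(1 + \<mu>) * (1 - B * w) \<le> 1 + A * w" for \<mu>
    using that by (simp add: algebra_simps)
  ultimately have "4 / p * M * x \<le> A * w + B * w + 4 / p * M * x * (B * w)"
    by blast
  also have "4 / p * M * x * (B * w) \<le> 4 / p * M * x * (1 / 2)"
    using Bw M p x0 by (intro mult_left_mono) auto
  finally have *: "4 / p * M * x \<le> A * w + B * w + 4 / p * M * x * (1 / 2)"
    by simp
  have "2 / p * M * x \<le> C * w"
  proof -
    have "k / 2 \<le> c" if "k \<le> c + k * (1 / 2)" for k c :: real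
      using that by linarith
    from this[OF *] show ?thesis
      by (simp add: AB(1) distrib_right)
  qed
  also have "C * w = (C * (p / 4) + C * x * M) * x"
    unfolding w(1) by (simp add: algebra_simps power2_eq_square)
  finally have "2 / p * M \<le> C * (p / 4) + C * x * M"
    using x0(1) by (rule mult_right_le_imp_le)
  also have "C * x * M \<le> 1 / p * M"
    using X(4) p M by (intro mult_right_mono) (auto simp: field_simps)
  finally have "2 / p * M \<le> C * (p / 4) + 1 / p * M"
    by simp
  moreover have "m \<le> c" if "2 * m \<le> c + m" for m c :: real
    using that by linarith
  ultimately have "1 / p * M \<le> C * (p / 4)"
    by simp
  then show ?thesis
    using p by (simp add: field_simps power2_eq_square)
qed

lemma eventually_powr_gt:
  fixes c p :: real
  assumes "p > 0"
  shows "\<forall>\<^sub>F r in at_top. r powr p > c"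
  using eventually_gt_at_top[of "max c 1 powr (1 / p)"]
proof eventually_elim
  case (elim r)
  have "(max c 1 powr (1 / p)) powr p < r powr p"
    using elim assms by (intro powr_less_mono2) auto
  then show ?case using assms by (simp add: powr_powr)
qed

context el_profile
begin

lemma eventually_ge: "\<forall>\<^sub>F r in at_top. f r > c" if "c < 1"
  using order_tendstoD(1)[OF lim that] .

lemma upper_barrier:
  "\<exists>M. \<forall>\<^sub>F r in at_top. f r \<le> 1 - p / 4 * r powr - p + M * (r powr - p)\<^sup>2"
proof -
  define A where "A = p^4 + 2 * p^3 + 2 * p^2"
  have x0: "((\<lambda>r. r powr - p) \<longlongrightarrow> 0) at_top"
    using p by (intro tendsto_powr_minus_at_top) auto
  have "\<forall>\<^sub>F r in at_top. f r \<le> 1 \<and> f r > 1/2 \<and> r powr - p < 1 / p\<^sup>2 \<and> r powr p > 8 * A + p\<^sup>2 \<and> r > 0"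
    using p by (intro eventually_conj eventually_f_le_1 eventually_ge order_tendstoD(2)[OF x0]
        eventually_gt_at_top eventually_powr_gt) auto
  then obtain R where R: "\<And>r. r \<ge> R \<Longrightarrow> f r \<le> 1 \<and> f r > 1/2 \<and> r powr - p < 1 / p\<^sup>2 \<and> r powr p > 8 * A + p\<^sup>2 \<and> r > 0"
    unfolding eventually_at_top_linorder by blast
  \<comment> \<open>\<open>M\<close> is such that the barrier equals \<open>1 \<ge> f R\<close> at \<open>R\<close>; this value exceeds the bound of
    \<open>EL_upper_bound\<close> once \<open>R\<close> is large.\<close>
  define M where "M = p / 4 * R powr p"
  have R0: "R > 0" using R[of R] by simp
  have M0: "M \<ge> 0" using p by (simp add: M_def)
  define g where "g r = 1 - p / 4 * r powr - p + M * (r powr - p)\<^sup>2" for r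
  define g1 where "g1 r = (p * (p / 4) * r powr - p - 2 * p * M * (r powr - p)\<^sup>2) / r" for r
  define g2 where "g2 r = (- (p * (p + 1) * (p / 4) * r powr - p) + 2 * p * (2 * p + 1) * M * (r powr - p)\<^sup>2) / r\<^sup>2" for r
  have dg: "(g has_real_derivative g1 r) (at r)" "(g1 has_real_derivative g2 r) (at r)" if "r > 0" for r
    unfolding g_def g1_def g2_def using barrier_derivs[OF that, where p = p and a = "p / 4" and b = M] .
  have gR: "g R = 1"
    using R0 by (simp add: g_def M_def powr_minus power2_eq_square field_simps)
  have glim: "(g \<longlongrightarrow> 1) at_top"
    unfolding g_def using p by (intro barrier_tendsto) auto
  have "f s \<le> g s" if s: "s \<ge> R" for s
  proof (rule ccontr)
    assume "\<not> f s \<le> g s"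
    then have fs: "f s - g s > 0" by simp
    obtain m where m: "m > R" "f m - g m > 0" "f1 m - g1 m = 0" "f2 m - g2 m \<le> 0"
    proof (rule interior_max[where h = "\<lambda>r. f r - g r" and ?h1.0 = "\<lambda>r. f1 r - g1 r"
          and ?h2.0 = "\<lambda>r. f2 r - g2 r", OF R0 _ _ _ _ s fs])
      show "f R - g R \<le> 0" using R[of R] gR by simp
      show "((\<lambda>r. f r - g r) \<longlongrightarrow> 0) at_top"
        using tendsto_diff[OF lim glim] by simp
      show "((\<lambda>r. f r - g r) has_real_derivative f1 r - g1 r) (at r)" if "r > 0" for r
        by (intro DERIV_diff d1 dg that)
      show "((\<lambda>r. f1 r - g1 r) has_real_derivative f2 r - g2 r) (at r)" if "r > 0" for r
        by (intro DERIV_diff d2 dg that)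
    qed blast
    define x where "x = m powr - p"
    have Rm: "f m \<le> 1" "f m > 1/2" "x < 1 / p\<^sup>2" "m > 0"
      using R[of m] m(1) by (auto simp: x_def)
    have xpos: "x > 0" using Rm by (simp add: x_def)
    have Mx: "M * x \<le> p / 4"
    proof -
      have "R powr p * x \<le> m powr p * x"
        using m(1) R0 p xpos by (intro mult_right_mono powr_mono2) auto
      also have "\<dots> = 1"
        using Rm by (simp add: x_def powr_minus)
      finally have "p / 4 * (R powr p * x) \<le> p / 4 * 1"
        using p by (intro mult_left_mono) auto
      then show ?thesis by (simp add: M_def mult.assoc)
    qed
    have Mx2: "0 \<le> M * x\<^sup>2" "M * x\<^sup>2 \<le> p / 4 * x"
      using Mx xpos M0 mult_right_mono[OF Mx, of x] by (auto simp: power2_eq_square mult.assoc)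
    have px: "p * x \<le> p\<^sup>2 * x" "p\<^sup>2 * x \<le> 1" "p\<^sup>2 * x \<le> p^3 * x"
      using p xpos Rm(3) by (auto simp: power2_eq_square power3_eq_cube field_simps)
    have "m * f1 m = p * (p / 4 * x) - 2 * p * (M * x\<^sup>2)"
      using m(3) Rm(4) by (simp add: g1_def x_def)
    moreover have "2 * p * (M * x\<^sup>2) \<le> 2 * p * (p / 4 * x)" "0 \<le> 2 * p * (M * x\<^sup>2)"
      using Mx2 p by (auto intro!: mult_left_mono)
    moreover have "p * (p / 4 * x) = p\<^sup>2 * x / 4" "2 * p * (p / 4 * x) = p\<^sup>2 * x / 2" "0 \<le> p\<^sup>2 * x"
      using xpos by (simp_all add: power2_eq_square)
    ultimately have y: "\<bar>m * f1 m\<bar> \<le> p\<^sup>2 * x"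
      by linarith
    have "m\<^sup>2 * g2 m = - (p * (p + 1) * (p / 4 * x)) + 2 * p * (2 * p + 1) * (M * x\<^sup>2)"
      using Rm(4) by (simp add: g2_def x_def)
    also have "\<dots> \<le> - (p * (p + 1) * (p / 4 * x)) + 2 * p * (2 * p + 1) * (p / 4 * x)"
      using Mx2 p by (intro add_left_mono mult_left_mono) auto
    also have "\<dots> \<le> p^3 * x"
      using px(3) by (simp add: algebra_simps power2_eq_square power3_eq_cube)
    finally have gz: "m\<^sup>2 * g2 m \<le> p^3 * x" .
    have "m\<^sup>2 * f2 m \<le> m\<^sup>2 * g2 m"
      using m(4) by (intro mult_left_mono) auto
    then have z: "m\<^sup>2 * f2 m \<le> p^3 * x"
      using gz by linarith
    have v: "1 - f m \<le> p / 4 * x - M * x\<^sup>2"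
      using m(2) by (simp add: g_def x_def)
    have "M \<le> p / 4 * (8 * A + p\<^sup>2)"
      unfolding A_def
      by (rule EL_upper_bound[where r = m and X = "m powr p" and x = x and v = "f m" and y = "m * f1 m" and z = "m\<^sup>2 * f2 m"])
        (use M0 Mx Rm v y z px p EL[of m] in \<open>auto simp: x_def powr_minus_divide\<close>)
    then have "R powr p \<le> 8 * A + p\<^sup>2"
      using p by (simp add: M_def)
    then show False using R[of R] by simp
  qed
  then show ?thesis
    unfolding g_def by (intro exI[of _ M] eventually_at_top_linorderI[of R])
qed

lemma lower_barrier:
  "\<exists>M. \<forall>\<^sub>F r in at_top. f r \<ge> 1 - p / 4 * r powr - p - M * (r powr - p)\<^sup>2"
proof -
  define C where "C = 8 * (2 * p * (2 * p + 1) * p + 2 * p^2) + (2 * p^2 + 1)"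
  have C: "C > 0" using p by (auto simp: C_def intro!: add_pos_pos)
  define w0 where "w0 = 1 / (2 * C)"
  have w0: "w0 > 0" using C by (simp add: w0_def)
  define \<eta> where "\<eta> = w0 / 2"
  have \<eta>: "\<eta> > 0" using w0 by (simp add: \<eta>_def)
  have x0: "((\<lambda>r. r powr - p) \<longlongrightarrow> 0) at_top"
    using p by (intro tendsto_powr_minus_at_top) auto
  have "\<forall>\<^sub>F r in at_top. f1 r \<ge> 0 \<and> f r \<le> 1 \<and> f r > 1/2 \<and> f r > 1 - \<eta> \<and> r powr - p < 1 / (p * C) \<and>
      r powr - p < \<eta> / (p / 4) \<and> r powr p > max 1 (p\<^sup>2 / 4 * C / \<eta>) \<and> r > 0"
    using p C \<eta> by (intro eventually_conj eventually_f1_nonneg eventually_f_le_1 eventually_ge order_tendstoD(2)[OF x0]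
        eventually_gt_at_top eventually_powr_gt) auto
  then obtain R where R: "\<And>r. r \<ge> R \<Longrightarrow> f1 r \<ge> 0 \<and> f r \<le> 1 \<and> f r > 1/2 \<and> f r > 1 - \<eta> \<and> r powr - p < 1 / (p * C) \<and>
      r powr - p < \<eta> / (p / 4) \<and> r powr p > max 1 (p\<^sup>2 / 4 * C / \<eta>) \<and> r > 0"
    unfolding eventually_at_top_linorder by blast
  define M where "M = \<eta> * (R powr p)\<^sup>2"
  have R0: "R > 0" using R[of R] by simp
  have M0: "M \<ge> 0" using \<eta> by (simp add: M_def)
  define g where "g r = 1 - p / 4 * r powr - p + (- M) * (r powr - p)\<^sup>2" for r
  define g1 where "g1 r = (p * (p / 4) * r powr - p - 2 * p * (- M) * (r powr - p)\<^sup>2) / r" for r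
  define g2 where "g2 r = (- (p * (p + 1) * (p / 4) * r powr - p) + 2 * p * (2 * p + 1) * (- M) * (r powr - p)\<^sup>2) / r\<^sup>2" for r
  have dg: "(g has_real_derivative g1 r) (at r)" "(g1 has_real_derivative g2 r) (at r)" if "r > 0" for r
    unfolding g_def g1_def g2_def using barrier_derivs[OF that, where p = p and a = "p / 4" and b = "- M"] .
  have gR: "g R \<le> 1 - \<eta>"
  proof -
    have "M * (R powr - p)\<^sup>2 = \<eta>"
      using R0 by (simp add: M_def powr_minus power2_eq_square field_simps)
    then show ?thesis using p by (simp add: g_def)
  qed
  have glim: "(g \<longlongrightarrow> 1) at_top"
    unfolding g_def using p by (intro barrier_tendsto) auto
  have "g s \<le> f s" if s: "s \<ge> R" for s
  proof (rule ccontr)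
    assume "\<not> g s \<le> f s"
    then have fs: "g s - f s > 0" by simp
    obtain m where m: "m > R" "g m - f m > 0" "g1 m - f1 m = 0" "g2 m - f2 m \<le> 0"
    proof (rule interior_max[where h = "\<lambda>r. g r - f r" and ?h1.0 = "\<lambda>r. g1 r - f1 r"
          and ?h2.0 = "\<lambda>r. g2 r - f2 r", OF R0 _ _ _ _ s fs])
      show "g R - f R \<le> 0" using R[of R] gR by simp
      show "((\<lambda>r. g r - f r) \<longlongrightarrow> 0) at_top"
        using tendsto_diff[OF glim lim] by simp
      show "((\<lambda>r. g r - f r) has_real_derivative g1 r - f1 r) (at r)" if "r > 0" for r
        by (intro DERIV_diff d1 dg that)
      show "((\<lambda>r. g1 r - f1 r) has_real_derivative g2 r - f2 r) (at r)" if "r > 0" for r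
        by (intro DERIV_diff d2 dg that)
    qed blast
    define x where "x = m powr - p"
    have Rm: "f m \<le> 1" "f m > 1/2" "x < 1 / (p * C)" "x < \<eta> / (p / 4)" "m > 0" "f1 m \<ge> 0"
      using R[of m] m(1) by (auto simp: x_def)
    have xpos: "x > 0" using Rm by (simp add: x_def)
    define w where "w = p / 4 * x + M * x\<^sup>2"
    have "R powr p * x \<le> m powr p * x"
      using m(1) R0 p xpos by (intro mult_right_mono powr_mono2) auto
    also have "\<dots> = 1"
      using Rm by (simp add: x_def powr_minus)
    finally have "(R powr p * x)\<^sup>2 \<le> 1"
      using xpos by (simp add: power_le_one)
    then have Mx2: "M * x\<^sup>2 \<le> \<eta>" "0 \<le> M * x\<^sup>2"
      using \<eta> M0 mult_left_mono[of "(R powr p * x)\<^sup>2" 1 \<eta>] by (auto simp: M_def power_mult_distrib mult.assoc)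
    moreover have "p / 4 * x \<le> \<eta>"
      using Rm(4) p by (simp add: field_simps)
    ultimately have "w \<le> w0"
      by (simp add: w_def \<eta>_def)
    then have "2 * C * w \<le> 2 * C * w0"
      using C by (intro mult_left_mono) auto
    then have w: "2 * C * w \<le> 1"
      using C by (simp add: w0_def)
    have pCx: "p * C * x \<le> 1"
      using Rm(3) p C by (simp add: field_simps)
    have px: "0 \<le> p / 4 * x" using p xpos by simp
    have "m * f1 m = p * (p / 4 * x) + 2 * p * (M * x\<^sup>2)"
    proof -
      have "f1 m = g1 m" using m(3) by simp
      then show ?thesis using Rm(5) by (simp add: g1_def x_def)
    qed
    also have "\<dots> \<le> 2 * p * (p / 4 * x) + 2 * p * (M * x\<^sup>2)"
      using p px by (intro add_right_mono mult_right_mono) auto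
    finally have y: "m * f1 m \<le> 2 * p * w"
      by (simp add: w_def distrib_left)
    have "m\<^sup>2 * g2 m = - (p * (p + 1) * (p / 4 * x) + 2 * p * (2 * p + 1) * (M * x\<^sup>2))"
      using Rm(5) by (simp add: g2_def x_def)
    moreover have "p * (p + 1) * (p / 4 * x) \<le> 2 * p * (2 * p + 1) * (p / 4 * x)"
      using p px by (intro mult_right_mono mult_mono) auto
    ultimately have gz: "m\<^sup>2 * g2 m \<ge> - (2 * p * (2 * p + 1) * w)"
      by (simp add: w_def distrib_left)
    have "m\<^sup>2 * g2 m \<le> m\<^sup>2 * f2 m"
      using m(4) by (intro mult_left_mono) auto
    then have z: "m\<^sup>2 * f2 m \<ge> - (2 * p * (2 * p + 1) * w)"
      using gz by linarith
    have v: "1 - f m \<ge> w"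
      using m(2) by (simp add: g_def x_def w_def)
    have "M \<le> p\<^sup>2 / 4 * C"
      unfolding C_def
      by (rule EL_lower_bound[where r = m and X = "m powr p" and x = x and v = "f m" and w = w and y = "m * f1 m" and z = "m\<^sup>2 * f2 m"])
        (use M0 Rm v y z pCx p w EL[of m] w_def in \<open>auto simp: x_def powr_minus_divide C_def\<close>)
    moreover have "p\<^sup>2 / 4 * C < \<eta> * R powr p"
      using R[of R] \<eta> by (simp add: field_simps)
    moreover have "\<eta> * R powr p \<le> M"
      unfolding M_def using R[of R] \<eta> by (intro mult_left_mono) (auto simp: power2_eq_square)
    ultimately show False by linarith
  qed
  then show ?thesis
    unfolding g_def by (intro exI[of _ M] eventually_at_top_linorderI[of R]) auto
qed

lemma expansion:
  obtains M where "M > 0" "\<forall>\<^sub>F r in at_top. \<bar>1 - f r - p / 4 * r powr - p\<bar> \<le> M * (r powr - p)\<^sup>2"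
proof -
  obtain M1 M2 where M: "\<forall>\<^sub>F r in at_top. f r \<le> 1 - p / 4 * r powr - p + M1 * (r powr - p)\<^sup>2"
    "\<forall>\<^sub>F r in at_top. f r \<ge> 1 - p / 4 * r powr - p - M2 * (r powr - p)\<^sup>2"
    using upper_barrier lower_barrier by blast
  define M where "M = max 1 (max M1 M2)"
  have "\<forall>\<^sub>F r in at_top. \<bar>1 - f r - p / 4 * r powr - p\<bar> \<le> M * (r powr - p)\<^sup>2"
    using M
  proof eventually_elim
    case (elim r)
    have "M1 * (r powr - p)\<^sup>2 \<le> M * (r powr - p)\<^sup>2" "M2 * (r powr - p)\<^sup>2 \<le> M * (r powr - p)\<^sup>2"
      by (auto simp: M_def intro!: mult_right_mono)
    then show ?case using elim by linarith
  qed
  then show ?thesis using that[of M] by (simp add: M_def)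
qed

lemma defect_limit: "((\<lambda>r. (1 - (f r)\<^sup>2) * r powr p) \<longlongrightarrow> p / 2) at_top"
proof -
  obtain M where M: "M > 0" "\<forall>\<^sub>F r in at_top. \<bar>1 - f r - p / 4 * r powr - p\<bar> \<le> M * (r powr - p)\<^sup>2"
    by (rule expansion)
  have "((\<lambda>r. (1 - f r) * r powr p - p / 4) \<longlongrightarrow> 0) at_top"
  proof (rule tendsto_rabs_zero_cancel, rule tendsto_sandwich[where f = "\<lambda>_. 0" and h = "\<lambda>r. M * r powr - p"])
    show "\<forall>\<^sub>F r in at_top. \<bar>(1 - f r) * r powr p - p / 4\<bar> \<le> M * r powr - p"
      using M(2) eventually_gt_at_top[of 0]
    proof eventually_elim
      case (elim r)
      have xX: "r powr - p * r powr p = 1" using elim by (simp add: powr_minus)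
      have "(1 - f r) * r powr p - p / 4 * (r powr - p * r powr p) = (1 - f r - p / 4 * r powr - p) * r powr p"
        by (simp add: algebra_simps)
      then have "\<bar>(1 - f r) * r powr p - p / 4\<bar> = \<bar>1 - f r - p / 4 * r powr - p\<bar> * r powr p"
        unfolding xX by (simp add: abs_mult)
      also have "\<dots> \<le> M * (r powr - p)\<^sup>2 * r powr p"
        using elim by (intro mult_right_mono) auto
      also have "\<dots> = M * r powr - p * (r powr - p * r powr p)"
        by (simp add: power2_eq_square)
      finally show ?case unfolding xX by simp
    qed
    have "((\<lambda>r. M * r powr - p) \<longlongrightarrow> M * 0) at_top"
      using p by (intro tendsto_intros tendsto_powr_minus_at_top) auto
    then show "((\<lambda>r. M * r powr - p) \<longlongrightarrow> 0) at_top" by simp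
  qed auto
  then have "((\<lambda>r. ((1 - f r) * r powr p - p / 4 + p / 4) * (1 + f r)) \<longlongrightarrow> (0 + p / 4) * (1 + 1)) at_top"
    by (intro tendsto_intros lim)
  then show ?thesis
    by (simp add: algebra_simps power2_eq_square)
qed

end

section \<open>Asymptotics of the derivative\<close>

context el_profile
begin

definition kappa :: "real \<Rightarrow> real" where
  "kappa r = 2 / p * (1 - (f r)\<^sup>2) * r powr p * ((f r)\<^sup>2 + (r * f1 r)\<^sup>2) powr (1 - p/2)"

lemma eventually_kappa_le:
  assumes "\<epsilon> > 0"
  shows "\<forall>\<^sub>F r in at_top. kappa r \<le> 1 + \<epsilon>"
proof -
  have "((\<lambda>r. 2 / p * ((1 - (f r)\<^sup>2) * r powr p) * ((f r)\<^sup>2) powr (1 - p/2)) \<longlongrightarrow> 2 / p * (p / 2) * (1\<^sup>2) powr (1 - p/2)) at_top"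
    by (intro tendsto_intros defect_limit lim) auto
  then have "((\<lambda>r. 2 / p * ((1 - (f r)\<^sup>2) * r powr p) * ((f r)\<^sup>2) powr (1 - p/2)) \<longlongrightarrow> 1) at_top"
    using p by simp
  then have "\<forall>\<^sub>F r in at_top. 2 / p * ((1 - (f r)\<^sup>2) * r powr p) * ((f r)\<^sup>2) powr (1 - p/2) < 1 + \<epsilon>"
    using assms by (intro order_tendstoD(2)) auto
  then show ?thesis
    using eventually_ge[of 0, simplified] eventually_f_le_1
  proof eventually_elim
    case (elim r)
    have "((f r)\<^sup>2 + (r * f1 r)\<^sup>2) powr (1 - p/2) \<le> ((f r)\<^sup>2) powr (1 - p/2)"
      using elim p by (intro powr_mono2') auto
    moreover have "(f r)\<^sup>2 \<le> 1"
      using elim by (simp add: power_le_one)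
    then have "0 \<le> 2 / p * (1 - (f r)\<^sup>2) * r powr p"
      using p by (intro mult_nonneg_nonneg) auto
    ultimately have "kappa r \<le> 2 / p * (1 - (f r)\<^sup>2) * r powr p * ((f r)\<^sup>2) powr (1 - p/2)"
      unfolding kappa_def by (intro mult_left_mono)
    then show ?case using elim unfolding mult.assoc by linarith
  qed
qed

lemma EL_kappa:
  assumes "r > 0" "f r > 0"
  shows "r\<^sup>2 * f2 r * ((f r)\<^sup>2 + (r * f1 r)\<^sup>2 + (p - 2) * (r * f1 r)\<^sup>2) =
      ((f r)\<^sup>2 + (r * f1 r)\<^sup>2) * f r * (1 - kappa r)
      - ((f r)\<^sup>2 + (r * f1 r)\<^sup>2) * (r * f1 r) - (p - 2) * (r * f1 r) * (f r * (r * f1 r) - (f r)\<^sup>2)"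
  using EL[OF assms] by (simp add: EL_def kappa_def)

lemma f2_lower_bound:
  assumes r: "r > 0" "0 < f r" "f r \<le> 1" "f1 r \<ge> 0" and k: "kappa r \<le> 1 + \<epsilon>" and e: "\<epsilon> \<ge> 0"
  shows "r\<^sup>2 * f2 r \<ge> - \<epsilon> - (p - 1) * (r * f1 r)"
proof -
  define v y S where "v = f r" and "y = r * f1 r" and "S = v\<^sup>2 + y\<^sup>2"
  have vy: "0 < v" "v \<le> 1" "0 \<le> y" using r by (auto simp: v_def y_def)
  have S: "S > 0" using vy by (auto simp: S_def intro: add_pos_nonneg)
  have D: "S \<le> S + (p - 2) * y\<^sup>2" using p by simp
  have eq: "r\<^sup>2 * f2 r * (S + (p - 2) * y\<^sup>2) = S * v * (1 - kappa r) - S * y - (p - 2) * y * (v * y - v\<^sup>2)"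
    using EL_kappa[OF r(1,2)] by (simp add: v_def y_def S_def)
  have "S * v * (1 - kappa r) \<ge> S * v * (- \<epsilon>)"
    using S vy k by (intro mult_left_mono) auto
  moreover have "S * v * \<epsilon> \<le> S * 1 * \<epsilon>"
    using S vy e by (intro mult_right_mono mult_left_mono) auto
  ultimately have 1: "S * v * (1 - kappa r) \<ge> - (S * \<epsilon>)" by simp
  have "v * y - v\<^sup>2 \<le> S"
  proof -
    have "0 \<le> v * y" using vy by simp
    then show ?thesis
      using sum_squares_bound[of v y] zero_le_power2[of v] unfolding S_def by linarith
  qed
  then have 2: "(p - 2) * y * (v * y - v\<^sup>2) \<le> (p - 2) * y * S"
    using p vy by (intro mult_left_mono) auto
  have "r\<^sup>2 * f2 r * (S + (p - 2) * y\<^sup>2) \<ge> - (S * (\<epsilon> + (p - 1) * y))"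
    using 1 2 unfolding eq by (simp add: algebra_simps)
  moreover have "S * (\<epsilon> + (p - 1) * y) \<le> (S + (p - 2) * y\<^sup>2) * (\<epsilon> + (p - 1) * y)"
    using D p vy e by (intro mult_right_mono) auto
  ultimately have "(- (\<epsilon> + (p - 1) * y)) * (S + (p - 2) * y\<^sup>2) \<le> r\<^sup>2 * f2 r * (S + (p - 2) * y\<^sup>2)"
    by (simp add: algebra_simps)
  then have "- (\<epsilon> + (p - 1) * y) \<le> r\<^sup>2 * f2 r"
    by (rule mult_right_le_imp_le) (use S D in linarith)
  then show ?thesis by (simp add: y_def)
qed

text \<open>By the one-sided bound on \<open>f''\<close>, \<open>r\<^bsup>p-2\<^esup> (r f' + \<epsilon>/(p-2))\<close> is nondecreasing, so a large
  value of \<open>r f'\<close> would persist on \<open>[r, 2r]\<close> and force \<open>f\<close> to increase too much there.\<close>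

lemma scaled_deriv_tendsto_0: "((\<lambda>r. r * f1 r) \<longlongrightarrow> 0) at_top"
proof -
  have ev: "\<forall>\<^sub>F r in at_top. r * f1 r \<le> 2 powr (p - 2) * (2 * (1 - f r) + \<epsilon> / (p - 2))" if e: "\<epsilon> > 0" for \<epsilon>
  proof -
    have "\<forall>\<^sub>F r in at_top. r > 0 \<and> 0 < f r \<and> f r \<le> 1 \<and> f1 r \<ge> 0 \<and> kappa r \<le> 1 + \<epsilon>"
      using eventually_ge[of 0] by (intro eventually_conj eventually_gt_at_top eventually_f1_nonneg eventually_f_le_1
        eventually_kappa_le e) auto
    then obtain R where R: "\<And>r. r \<ge> R \<Longrightarrow> r > 0 \<and> 0 < f r \<and> f r \<le> 1 \<and> f1 r \<ge> 0 \<and> kappa r \<le> 1 + \<epsilon>"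
      unfolding eventually_at_top_linorder by blast
    define n where "n r = r powr (p - 2) * (r * f1 r + \<epsilon> / (p - 2))" for r
    have n: "n r \<le> n s" if rs: "R \<le> r" "r \<le> s" for r s
    proof (rule DERIV_nonneg_imp_nondecreasing[OF rs(2)])
      fix t assume t: "r \<le> t" "t \<le> s"
      have Rt: "t > 0" "0 < f t" "f t \<le> 1" "f1 t \<ge> 0" "kappa t \<le> 1 + \<epsilon>"
        using R[of t] t rs by auto
      have dp: "((\<lambda>r. r powr (p - 2)) has_real_derivative (p - 2) * t powr (p - 2) / t) (at t)"
        using DERIV_powr_minus[OF Rt(1), of "- (p - 2)"] by simp
      have "(n has_real_derivative ((p - 2) * t powr (p - 2) / t) * (t * f1 t + \<epsilon> / (p - 2))
          + (1 * f1 t + f2 t * t + 0) * t powr (p - 2)) (at t)"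
        unfolding n_def by (intro DERIV_mult DERIV_add DERIV_const DERIV_ident dp d2 Rt)
      moreover have "((p - 2) * t powr (p - 2) / t) * (t * f1 t + \<epsilon> / (p - 2))
          + (1 * f1 t + f2 t * t + 0) * t powr (p - 2)
          = t powr (p - 2) / t * (t\<^sup>2 * f2 t + (p - 1) * (t * f1 t) + \<epsilon>)"
        using Rt(1) p by (simp add: field_simps power2_eq_square)
      moreover have "\<dots> \<ge> 0"
        using f2_lower_bound[OF Rt] e Rt(1) by (intro mult_nonneg_nonneg) auto
      ultimately show "\<exists>y. (n has_real_derivative y) (at t) \<and> 0 \<le> y" by metis
    qed
    have "r * f1 r \<le> 2 powr (p - 2) * (2 * (1 - f r) + \<epsilon> / (p - 2))" if r: "r \<ge> R" for r
    proof -
      have r0: "r > 0" using R[OF r] by simp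
      obtain s where s: "r < s" "s < 2 * r" "f (2 * r) - f r = (2 * r - r) * f1 s"
        using MVT2[of r "2 * r" f f1] d1 r0 by auto
      have fs: "f1 s \<ge> 0" using R[of s] s r by simp
      have "s * f1 s \<le> 2 * r * f1 s"
        using s fs by (intro mult_right_mono) auto
      also have "\<dots> = 2 * (f (2 * r) - f r)" using s(3) by simp
      also have "\<dots> \<le> 2 * (1 - f r)" using R[of "2 * r"] r r0 by simp
      finally have ys: "s * f1 s \<le> 2 * (1 - f r)" .
      have e': "\<epsilon> / (p - 2) > 0" using e p by simp
      have fr: "1 - f r \<ge> 0" using R[OF r] by simp
      have "n r \<le> n s" using n[OF r] s by simp
      also have "n s \<le> (2 * r) powr (p - 2) * (2 * (1 - f r) + \<epsilon> / (p - 2))"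
        unfolding n_def using s r0 p ys fs e' by (intro mult_mono powr_mono2) auto
      also have "\<dots> = r powr (p - 2) * (2 powr (p - 2) * (2 * (1 - f r) + \<epsilon> / (p - 2)))"
        using r0 by (simp add: powr_mult)
      finally have "r powr (p - 2) * (r * f1 r + \<epsilon> / (p - 2)) \<le> r powr (p - 2) * (2 powr (p - 2) * (2 * (1 - f r) + \<epsilon> / (p - 2)))"
        unfolding n_def .
      then have "r * f1 r + \<epsilon> / (p - 2) \<le> 2 powr (p - 2) * (2 * (1 - f r) + \<epsilon> / (p - 2))"
        by (rule mult_left_le_imp_le) (use r0 in simp)
      then show ?thesis using e' by linarith
    qed
    then show ?thesis by (intro eventually_at_top_linorderI[of R])
  qed
  show ?thesis
  proof (rule tendstoI)
    fix e :: real assume e: "e > 0"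
    define \<epsilon> where "\<epsilon> = (p - 2) * (e / 2) / 2 powr (p - 2)"
    have "\<epsilon> > 0" using e p by (simp add: \<epsilon>_def)
    have "((\<lambda>r. 2 powr (p - 2) * (2 * (1 - f r) + \<epsilon> / (p - 2))) \<longlongrightarrow> 2 powr (p - 2) * (2 * (1 - 1) + \<epsilon> / (p - 2))) at_top"
      by (intro tendsto_intros lim)
    moreover have "2 powr (p - 2) * (2 * (1 - 1) + \<epsilon> / (p - 2)) < e"
      using e p by (simp add: \<epsilon>_def)
    ultimately have "\<forall>\<^sub>F r in at_top. 2 powr (p - 2) * (2 * (1 - f r) + \<epsilon> / (p - 2)) < e"
      by (rule order_tendstoD(2))
    then show "\<forall>\<^sub>F r in at_top. dist (r * f1 r) 0 < e"
      using ev[OF \<open>\<epsilon> > 0\<close>] eventually_f1_nonneg eventually_gt_at_top[of 0]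
      by eventually_elim (auto simp: abs_mult)
  qed
qed

lemma kappa_tendsto_1: "(kappa \<longlongrightarrow> 1) at_top"
proof -
  have "((\<lambda>r. 2 / p * ((1 - (f r)\<^sup>2) * r powr p) * ((f r)\<^sup>2 + (r * f1 r)\<^sup>2) powr (1 - p/2))
      \<longlongrightarrow> 2 / p * (p / 2) * (1\<^sup>2 + 0\<^sup>2) powr (1 - p/2)) at_top"
    by (intro tendsto_intros defect_limit lim scaled_deriv_tendsto_0) auto
  moreover have "2 / p * (p / 2) * (1\<^sup>2 + 0\<^sup>2) powr (1 - p/2) = 1"
    using p by simp
  ultimately show ?thesis
    unfolding kappa_def[abs_def] by (simp only: mult.assoc)
qed

lemma scaled_second_deriv_tendsto_0: "((\<lambda>r. r\<^sup>2 * f2 r) \<longlongrightarrow> 0) at_top"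
proof -
  have "((\<lambda>r. (((f r)\<^sup>2 + (r * f1 r)\<^sup>2) * f r * (1 - kappa r)
      - ((f r)\<^sup>2 + (r * f1 r)\<^sup>2) * (r * f1 r) - (p - 2) * (r * f1 r) * (f r * (r * f1 r) - (f r)\<^sup>2))
      / ((f r)\<^sup>2 + (r * f1 r)\<^sup>2 + (p - 2) * (r * f1 r)\<^sup>2))
     \<longlongrightarrow> ((1\<^sup>2 + 0\<^sup>2) * 1 * (1 - 1) - (1\<^sup>2 + 0\<^sup>2) * 0 - (p - 2) * 0 * (1 * 0 - 1\<^sup>2))
      / (1\<^sup>2 + 0\<^sup>2 + (p - 2) * 0\<^sup>2)) at_top"
    by (intro tendsto_intros lim scaled_deriv_tendsto_0 kappa_tendsto_1) auto
  then have "((\<lambda>r. (((f r)\<^sup>2 + (r * f1 r)\<^sup>2) * f r * (1 - kappa r)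
      - ((f r)\<^sup>2 + (r * f1 r)\<^sup>2) * (r * f1 r) - (p - 2) * (r * f1 r) * (f r * (r * f1 r) - (f r)\<^sup>2))
      / ((f r)\<^sup>2 + (r * f1 r)\<^sup>2 + (p - 2) * (r * f1 r)\<^sup>2)) \<longlongrightarrow> 0) at_top"
    by simp
  then show ?thesis
  proof (rule Lim_transform_eventually)
    show "\<forall>\<^sub>F r in at_top. (((f r)\<^sup>2 + (r * f1 r)\<^sup>2) * f r * (1 - kappa r)
      - ((f r)\<^sup>2 + (r * f1 r)\<^sup>2) * (r * f1 r) - (p - 2) * (r * f1 r) * (f r * (r * f1 r) - (f r)\<^sup>2))
      / ((f r)\<^sup>2 + (r * f1 r)\<^sup>2 + (p - 2) * (r * f1 r)\<^sup>2) = r\<^sup>2 * f2 r"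
      using eventually_gt_at_top[of 0] eventually_ge[of 0, simplified]
    proof eventually_elim
      case (elim r)
      have "(f r)\<^sup>2 + (r * f1 r)\<^sup>2 + (p - 2) * (r * f1 r)\<^sup>2 > 0"
        using elim p by (intro add_pos_nonneg) auto
      then show ?case
        unfolding EL_kappa[OF elim, symmetric] by simp
    qed
  qed
qed

end

lemma deriv_interpolation:
  fixes e e1 e2 :: "real \<Rightarrow> real"
  assumes h: "h > 0"
    and d1: "\<And>s. r \<le> s \<Longrightarrow> s \<le> r + h \<Longrightarrow> (e has_real_derivative e1 s) (at s)"
    and d2: "\<And>s. r \<le> s \<Longrightarrow> s \<le> r + h \<Longrightarrow> (e1 has_real_derivative e2 s) (at s)"
    and E: "\<bar>e r\<bar> \<le> E" "\<bar>e (r + h)\<bar> \<le> E" and B: "\<And>s. r \<le> s \<Longrightarrow> s \<le> r + h \<Longrightarrow> \<bar>e2 s\<bar> \<le> B"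
  shows "\<bar>e1 r\<bar> \<le> 2 * E / h + h * B"
proof -
  obtain s where s: "r < s" "s < r + h" "e (r + h) - e r = (r + h - r) * e1 s"
    using MVT2[of r "r + h" e e1] h d1 by auto
  obtain t where t: "r < t" "t < s" "e1 s - e1 r = (s - r) * e2 t"
    using MVT2[OF s(1), of e1 e2] d2 s by auto
  have "e1 s = (e (r + h) - e r) / h"
    using s(3) h by simp
  then have "\<bar>e1 s\<bar> = \<bar>e (r + h) - e r\<bar> / h"
    using h by simp
  also have "\<dots> \<le> 2 * E / h"
    using E h by (intro divide_right_mono) auto
  finally have 1: "\<bar>e1 s\<bar> \<le> 2 * E / h" .
  have "\<bar>(s - r) * e2 t\<bar> \<le> h * B"
    unfolding abs_mult using s t B[of t] h by (intro mult_mono) auto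
  then show ?thesis using 1 t(3) by linarith
qed

context el_profile
begin

lemma deriv_limit: "((\<lambda>r. r * f1 r * r powr p) \<longlongrightarrow> p\<^sup>2 / 4) at_top"
proof -
  obtain M where M: "M > 0" "\<forall>\<^sub>F r in at_top. \<bar>1 - f r - p / 4 * r powr - p\<bar> \<le> M * (r powr - p)\<^sup>2"
    by (rule expansion)
  \<comment> \<open>The vanishing quadratic terms keep the shape of \<open>barrier_derivs\<close>.\<close>
  define e where "e r = (1 - p / 4 * r powr - p + 0 * (r powr - p)\<^sup>2) - f r" for r
  define e1 where "e1 r = (p * (p / 4) * r powr - p - 2 * p * 0 * (r powr - p)\<^sup>2) / r - f1 r" for r
  define e2 where "e2 r = (- (p * (p + 1) * (p / 4) * r powr - p) + 2 * p * (2 * p + 1) * 0 * (r powr - p)\<^sup>2) / r\<^sup>2 - f2 r" for r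
  have de: "(e has_real_derivative e1 r) (at r)" "(e1 has_real_derivative e2 r) (at r)" if "r > 0" for r
    unfolding e_def e1_def e2_def using that
    by (intro DERIV_diff barrier_derivs d1 d2; simp)+
  have "((\<lambda>r. - (p * (p + 1) * (p / 4) * r powr - p) - r\<^sup>2 * f2 r) \<longlongrightarrow> - (p * (p + 1) * (p / 4) * 0) - 0) at_top"
    using p by (intro tendsto_intros tendsto_powr_minus_at_top scaled_second_deriv_tendsto_0) auto
  then have lim2: "((\<lambda>r. - (p * (p + 1) * (p / 4) * r powr - p) - r\<^sup>2 * f2 r) \<longlongrightarrow> 0) at_top"
    by simp
  have "((\<lambda>r. r * e1 r * r powr p) \<longlongrightarrow> 0) at_top"
  proof (rule tendstoI)
    fix \<epsilon> :: real assume \<epsilon>: "\<epsilon> > 0"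
    define k where "k = 4 * M / \<epsilon>"
    define \<delta> where "\<delta> = \<epsilon> / (4 * k)"
    have k: "k > 0" using M \<epsilon> by (simp add: k_def)
    have \<delta>: "\<delta> > 0" using k \<epsilon> by (simp add: \<delta>_def)
    have "\<forall>\<^sub>F r in at_top. \<bar>1 - f r - p / 4 * r powr - p\<bar> \<le> M * (r powr - p)\<^sup>2 \<and>
        \<bar>- (p * (p + 1) * (p / 4) * r powr - p) - r\<^sup>2 * f2 r\<bar> < \<delta> \<and> r > 0"
      using tendstoD[OF lim2 \<delta>] by (intro eventually_conj M(2) eventually_gt_at_top) (simp add: dist_real_def)
    then obtain R where R: "\<And>r. r \<ge> R \<Longrightarrow> \<bar>1 - f r - p / 4 * r powr - p\<bar> \<le> M * (r powr - p)\<^sup>2 \<and>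
        \<bar>- (p * (p + 1) * (p / 4) * r powr - p) - r\<^sup>2 * f2 r\<bar> < \<delta> \<and> r > 0"
      unfolding eventually_at_top_linorder by blast
    have "\<bar>r * e1 r * r powr p\<bar> < \<epsilon>" if r: "r \<ge> R" for r
    proof -
      define x where "x = r powr - p"
      have r0: "r > 0" using R[OF r] by simp
      have x: "x > 0" "x * r powr p = 1" using r0 by (auto simp: x_def powr_minus)
      define h where "h = k * r * x"
      have h: "h > 0" using k r0 x by (simp add: h_def)
      have "\<bar>e1 r\<bar> \<le> 2 * (M * x\<^sup>2) / h + h * (\<delta> / r\<^sup>2)"
      proof (rule deriv_interpolation[where e = e and ?e1.0 = e1 and ?e2.0 = e2 and r = r, OF h])
        show "(e has_real_derivative e1 s) (at s)" "(e1 has_real_derivative e2 s) (at s)" if "r \<le> s" for s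
          using de that r0 by auto
        have ebound: "\<bar>e s\<bar> \<le> M * (s powr - p)\<^sup>2" if "s \<ge> R" for s
          using R[OF that] by (simp add: e_def abs_minus_commute algebra_simps)
        show "\<bar>e r\<bar> \<le> M * x\<^sup>2"
          using ebound[OF r] by (simp add: x_def)
        have "(r + h) powr - p \<le> x"
          unfolding x_def using r0 h p by (intro powr_mono2') auto
        then have "M * ((r + h) powr - p)\<^sup>2 \<le> M * x\<^sup>2"
          using M by (intro mult_left_mono power_mono) auto
        then show "\<bar>e (r + h)\<bar> \<le> M * x\<^sup>2"
          using ebound[of "r + h"] r h by linarith
        show "\<bar>e2 s\<bar> \<le> \<delta> / r\<^sup>2" if s: "r \<le> s" for s
        proof -
          have s0: "s > 0" using s r0 by simp
          have "s\<^sup>2 * e2 s = - (p * (p + 1) * (p / 4) * s powr - p) - s\<^sup>2 * f2 s"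
            using s0 by (simp add: e2_def right_diff_distrib)
          then have "s\<^sup>2 * \<bar>e2 s\<bar> < \<delta>"
            using R[of s] r s by (metis abs_mult abs_power2 order_trans)
          moreover have "r\<^sup>2 * \<bar>e2 s\<bar> \<le> s\<^sup>2 * \<bar>e2 s\<bar>"
            using s r0 by (intro mult_right_mono power_mono) auto
          ultimately show ?thesis
            using r0 by (simp add: field_simps)
        qed
      qed
      also have "2 * (M * x\<^sup>2) / h + h * (\<delta> / r\<^sup>2) = (2 * M / k + k * \<delta>) * (x / r)"
        using k r0 x(1) by (simp add: h_def field_simps power2_eq_square)
      also have "2 * M / k + k * \<delta> = 3 / 4 * \<epsilon>"
        using k M \<epsilon> by (simp add: \<delta>_def k_def)
      finally have "r * \<bar>e1 r\<bar> * r powr p \<le> r * (3 / 4 * \<epsilon> * (x / r)) * r powr p"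
        using r0 by (intro mult_left_mono mult_right_mono) auto
      also have "\<dots> = 3 / 4 * \<epsilon> * (x * r powr p)"
        using r0 by simp
      finally show ?thesis
        unfolding x(2) using r0 \<epsilon> by (simp add: abs_mult)
    qed
    then show "\<forall>\<^sub>F r in at_top. dist (r * e1 r * r powr p) 0 < \<epsilon>"
      by (intro eventually_at_top_linorderI[of R]) (simp add: dist_real_def)
  qed
  then have "((\<lambda>r. p\<^sup>2 / 4 - r * e1 r * r powr p) \<longlongrightarrow> p\<^sup>2 / 4 - 0) at_top"
    by (intro tendsto_intros)
  then have "((\<lambda>r. p\<^sup>2 / 4 - r * e1 r * r powr p) \<longlongrightarrow> p\<^sup>2 / 4) at_top" by simp
  then show ?thesis
  proof (rule Lim_transform_eventually)
    show "\<forall>\<^sub>F r in at_top. p\<^sup>2 / 4 - r * e1 r * r powr p = r * f1 r * r powr p"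
      using eventually_gt_at_top[of 0]
    proof eventually_elim
      case (elim r)
      have "r * e1 r * r powr p = p\<^sup>2 / 4 * (r powr - p * r powr p) - r * f1 r * r powr p"
        using elim by (simp add: e1_def algebra_simps power2_eq_square)
      then show ?case using elim by (simp add: powr_minus)
    qed
  qed
qed

end

theorem lemma2p4:
  fixes p :: real and f :: "real \<Rightarrow> real"
  assumes "p > 2"
    and "nonneg_minimizer p f"
    and "smooth_on {0<..} f"
  shows "(\<lambda>r. 1 - (f r)\<^sup>2) \<sim>[at_top] (\<lambda>r. p / 2 * (1 / r powr p)) \<and>
         (\<lambda>r. deriv f r) \<sim>[at_top] (\<lambda>r. p\<^sup>2 / 4 * (1 / r powr (p + 1)))"
proof
  interpret el_profile p f "deriv f" "deriv (deriv f)"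
    by (rule minimizer_el_profile[OF assms])
  show "(\<lambda>r. 1 - (f r)\<^sup>2) \<sim>[at_top] (\<lambda>r. p / 2 * (1 / r powr p))"
  proof (rule asymp_equivI')
    have "((\<lambda>r. (1 - (f r)\<^sup>2) * r powr p / (p / 2)) \<longlongrightarrow> p / 2 / (p / 2)) at_top"
      using assms(1) by (intro tendsto_intros defect_limit) auto
    then show "((\<lambda>r. (1 - (f r)\<^sup>2) / (p / 2 * (1 / r powr p))) \<longlongrightarrow> 1) at_top"
      using assms(1) by (simp add: mult_ac)
  qed
  show "(\<lambda>r. deriv f r) \<sim>[at_top] (\<lambda>r. p\<^sup>2 / 4 * (1 / r powr (p + 1)))"
  proof (rule asymp_equivI')
    have "((\<lambda>r. r * deriv f r * r powr p / (p\<^sup>2 / 4)) \<longlongrightarrow> p\<^sup>2 / 4 / (p\<^sup>2 / 4)) at_top"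
      using assms(1) by (intro tendsto_intros deriv_limit) auto
    then have "((\<lambda>r. r * deriv f r * r powr p / (p\<^sup>2 / 4)) \<longlongrightarrow> 1) at_top"
      using assms(1) by simp
    then show "((\<lambda>r. deriv f r / (p\<^sup>2 / 4 * (1 / r powr (p + 1)))) \<longlongrightarrow> 1) at_top"
    proof (rule Lim_transform_eventually)
      show "\<forall>\<^sub>F r in at_top. r * deriv f r * r powr p / (p\<^sup>2 / 4) = deriv f r / (p\<^sup>2 / 4 * (1 / r powr (p + 1)))"
        using eventually_gt_at_top[of 0] by eventually_elim (simp add: powr_add mult_ac)
    qed
  qed
qed

end
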